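(* Let $G$ be a finite Frobenius group whose Frobenius kernel $F$ is a nonabelian $q$-group, for some prime $q$, such that $1 < H_{q}(F) < F$, and whose Frobenius complement has prime order $p$. Then $p \geq 7$ and $q \geq 5$.
   Context: For a group $X$ and a prime $r$, the Hughes subgroup of $X$ relative to $r$ is $H_{r}(X) := \langle x \in X : x^{r} \neq 1\rangle$ (the subgroup generated by the empty set is trivial). The symbol $<$ between subgroups means proper containment, and $1$ denotes the trivial subgroup. *)

theory Defs
  imports "HOL-Algebra.Algebra"
begin

definition frobenius_complement :: "('a, 'b) monoid_scheme \<Rightarrow> 'a set \<Rightarrow> bool" where
  "frobenius_complement G H \<longleftrightarrow>
     subgroup H G \<and> H \<noteq> {\<one>\<^bsub>G\<^esub>} \<and> H \<noteq> carrier G \<and>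
     (\<forall>g \<in> carrier G - H. H \<inter> (g <#\<^bsub>G\<^esub> H #>\<^bsub>G\<^esub> inv\<^bsub>G\<^esub> g) = {\<one>\<^bsub>G\<^esub>})"

text \<open>A Frobenius group is a group with a Frobenius complement. Its kernel with respect to a
  complement \<open>H\<close> consists of the identity and the elements lying in no conjugate of \<open>H\<close>;
  that this set is a subgroup of a finite Frobenius group is a theorem of Frobenius.\<close>

definition frobenius_kernel :: "('a, 'b) monoid_scheme \<Rightarrow> 'a set \<Rightarrow> 'a set" where
  "frobenius_kernel G H =
     insert \<one>\<^bsub>G\<^esub> (carrier G - (\<Union>g \<in> carrier G. g <#\<^bsub>G\<^esub> H #>\<^bsub>G\<^esub> inv\<^bsub>G\<^esub> g))"

definition finite_p_group :: "nat \<Rightarrow> ('a, 'b) monoid_scheme \<Rightarrow> bool" where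
  "finite_p_group r K \<longleftrightarrow> group K \<and> finite (carrier K) \<and> (\<exists>n. order K = r ^ n)"

definition hughes_subgroup :: "nat \<Rightarrow> ('a, 'b) monoid_scheme \<Rightarrow> 'a set" where
  "hughes_subgroup r K = generate K {x \<in> carrier K. x [^]\<^bsub>K\<^esub> r \<noteq> \<one>\<^bsub>K\<^esub>}"

end

theory Submission
  imports Defs "HOL-Library.Numeral_Type" "HOL-Library.Product_Plus" "HOL-Library.Poly_Mapping"
begin

text \<open>A generator of the complement acts on the kernel \<open>F\<close> as a fixed-point-free automorphism \<open>f\<close> of
  order \<open>p\<close>, so \<open>x f(x) \<dots> f\<^sup>p\<^sup>-\<^sup>1(x) = 1\<close> for all \<open>x\<close>; for \<open>p = 2\<close> this makes \<open>F\<close> abelian.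

  Small \<open>q\<close>: if \<open>q = 2\<close> (\<open>q = 3\<close>) then the proper nontrivial Hughes subgroup \<open>H\<close> has index \<open>2\<close> (\<open>3\<close>),
  so \<open>f\<^sup>2\<close> acts trivially on \<open>F / H\<close>, although \<open>x \<mapsto> x\<^sup>-\<^sup>1 f\<^sup>2(x)\<close> is onto \<open>F\<close>.

  Small \<open>p\<close>: following Higman, \<open>F\<close> has class at most \<open>2\<close> if \<open>p = 3\<close> and at most \<open>6\<close> if \<open>p = 5\<close>. The
  associated Lie ring, tensored with \<open>\<int>[\<int>/p]\<close>, is graded by \<open>\<int>/p\<close> with zero component in degree \<open>0\<close>, and in
  such a ring every product of \<open>3\<close> (\<open>7\<close>) homogeneous elements vanishes. Hence the class is less than \<open>q\<close>
  whenever \<open>q \<ge> 5\<close>, \<open>q \<noteq> p\<close>. But then Hall's formula for \<open>(x h)\<^sup>q\<close> with \<open>x \<notin> H\<close> and \<open>h \<in> H\<close> as deep as possible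
  in the lower central series yields \<open>h\<^sup>q = 1\<close>, so \<open>H\<close> would be trivial.\<close>

section \<open>Graded modules over graded Lie rings without degree zero part\<close>

text \<open>Neither the associated Lie ring nor its extension of scalars is formed as a quotient. If
  \<open>c\<close> is the class, what has to vanish is a left-normed commutator of weight
  \<open>c\<close>, and its value lies in the central term \<open>N c\<close>. Words in group
  elements therefore become noncommutative polynomials over the group ring of \<int>/p, and additive
  maps into \<open>N c\<close> read each word as a left-normed commutator. These maps turn brackets
  \<open>x * y - y * x\<close> into group commutators, because the Jacobi identity for group
  commutators fails only in deeper terms. Being zero becomes membership in a set \<open>Z\<close> on
  which all these maps vanish, which is why the locale below speaks of subsets of an arbitrary ring.
  Division by p is replaced by the absence of p-torsion in a q-group, so p \<noteq> q has to be
  settled on the way. For p = 5 this also excludes q = 5 and leaves q \<ge> 7, just above the class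
  6.\<close>

locale graded_action =
  fixes M L :: "'n::comm_ring_1 \<Rightarrow> 'r::ring set" and Z :: "'r set"
  assumes M_mult: "u \<in> M s \<Longrightarrow> x \<in> L i \<Longrightarrow> u * x \<in> M (s + i)"
    and L_commutator: "x \<in> L i \<Longrightarrow> y \<in> L j \<Longrightarrow> x * y - y * x \<in> L (i + j)"
    and M_zero: "M 0 \<subseteq> Z"
    and L_zero: "u \<in> M s \<Longrightarrow> y \<in> L 0 \<Longrightarrow> u * y \<in> Z"
    and Z_add: "a \<in> Z \<Longrightarrow> b \<in> Z \<Longrightarrow> a + b \<in> Z"
    and Z_mult: "a \<in> Z \<Longrightarrow> a * x \<in> Z"
begin

lemma M_step: "u \<in> M s \<Longrightarrow> x \<in> L i \<Longrightarrow> s + i = t \<Longrightarrow> u * x \<in> M t"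
  using M_mult by blast

text \<open>A word \<open>k\<^sub>1 \<dots> k\<^sub>r\<close> lists the degrees of the acting elements relative to the degree \<open>s\<close> of the
  module element, so that multiplying all degrees by a unit leaves words unchanged.\<close>
definition dead :: "'n \<Rightarrow> 'n list \<Rightarrow> bool" where
  "dead s ks \<longleftrightarrow> (\<forall>u\<in>M s. \<forall>xs. list_all2 (\<lambda>x k. x \<in> L (k * s)) xs ks \<longrightarrow> foldl (*) u xs \<in> Z)"

lemma foldl_Z: "a \<in> Z \<Longrightarrow> foldl (*) a xs \<in> Z"
  by (induction xs arbitrary: a) (auto intro: Z_mult)

lemma dead_append: "dead s ks \<Longrightarrow> dead s (ks @ ks')"
  by (auto simp: dead_def list_all2_append2 foldl_Z)

text \<open>Absorbing the first letter moves the module element to degree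
  \<open>(1 + k) * s\<close>. A letter of degree \<open>j\<close> relative to the new degree has
  degree \<open>(1 + k) * j\<close> relative to \<open>s\<close>.\<close>

lemma dead_Cons:
  assumes "dead ((1 + k) * s) ks"
  shows "dead s (k # map (\<lambda>j. (1 + k) * j) ks)"
  unfolding dead_def
proof (intro ballI allI impI)
  fix u xs assume u: "u \<in> M s"
    and "list_all2 (\<lambda>x k. x \<in> L (k * s)) xs (k # map (\<lambda>j. (1 + k) * j) ks)"
  then obtain x ys where xs: "xs = x # ys" "x \<in> L (k * s)"
      "list_all2 (\<lambda>x j. x \<in> L (((1 + k) * j) * s)) ys ks"
    by (auto simp: list_all2_Cons2 list.rel_map)
  have "u * x \<in> M ((1 + k) * s)"
    using M_step[OF u xs(2)] by (simp add: algebra_simps)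
  moreover have "list_all2 (\<lambda>x j. x \<in> L (j * ((1 + k) * s))) ys ks"
    using xs(3) by (simp add: mult_ac)
  ultimately show "foldl (*) u xs \<in> Z"
    using assms unfolding dead_def xs(1) by simp
qed

lemma foldl_M:
  "u \<in> M s \<Longrightarrow> list_all2 (\<lambda>x k. x \<in> L (k * s)) xs ks \<Longrightarrow> foldl (*) u xs \<in> M ((1 + sum_list ks) * s)"
proof (induction ks arbitrary: xs rule: rev_induct)
  case (snoc k ks)
  then obtain ys y where "xs = ys @ [y]" "list_all2 (\<lambda>x k. x \<in> L (k * s)) ys ks" "y \<in> L (k * s)"
    by (auto simp: list_all2_append2 list_all2_Cons2)
  with snoc show ?case
    using M_mult[of "foldl (*) u ys" "(1 + sum_list ks) * s" y "k * s"] by (simp add: algebra_simps)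
qed auto

lemma dead_sum: "1 + sum_list ks = 0 \<Longrightarrow> dead s ks"
  using foldl_M M_zero by (fastforce simp: dead_def)

lemma dead_zero: "dead s [0]"
  by (auto simp: dead_def list_all2_Cons2 intro: L_zero)

text \<open>The only use of the Lie structure: \<open>x y = y x + [x, y]\<close> with \<open>[x, y]\<close> of degree \<open>k + l\<close>.\<close>
lemma dead_swap:
  assumes "dead s (pre @ l # k # post)" "dead s (pre @ (k + l) # post)"
  shows "dead s (pre @ k # l # post)"
  unfolding dead_def
proof (intro ballI allI impI)
  fix u zs assume u: "u \<in> M s" and "list_all2 (\<lambda>x k. x \<in> L (k * s)) zs (pre @ k # l # post)"
  then obtain xs x y ys where zs: "zs = xs @ x # y # ys"
    and xs: "list_all2 (\<lambda>x k. x \<in> L (k * s)) xs pre" and x: "x \<in> L (k * s)" and y: "y \<in> L (l * s)"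
    and ys: "list_all2 (\<lambda>x k. x \<in> L (k * s)) ys post"
    by (auto simp: list_all2_append2 list_all2_Cons2)
  have xy: "x * y - y * x \<in> L ((k + l) * s)"
    using L_commutator[OF x y] by (simp add: algebra_simps)
  let ?v = "foldl (*) u xs"
  have "foldl (*) u (xs @ y # x # ys) \<in> Z"
    using assms(1) u xs x y ys unfolding dead_def by (blast intro: list_all2_appendI list_all2_Cons[THEN iffD2])
  moreover have "foldl (*) u (xs @ (x * y - y * x) # ys) \<in> Z"
    using assms(2) u xs xy ys unfolding dead_def by (blast intro: list_all2_appendI list_all2_Cons[THEN iffD2])
  moreover have "foldl (*) (a + b) ys = foldl (*) a ys + foldl (*) b ys" for a b
    by (induction ys arbitrary: a b) (auto simp: algebra_simps)
  from this[of "?v * y * x" "?v * (x * y - y * x)"]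
  have "foldl (*) u zs = foldl (*) u (xs @ y # x # ys) + foldl (*) u (xs @ (x * y - y * x) # ys)"
    by (simp add: zs algebra_simps)
  ultimately show "foldl (*) u zs \<in> Z"
    using Z_add by simp
qed

definition killed :: "'n list \<Rightarrow> bool" where
  "killed ks \<longleftrightarrow> (\<forall>s. dead s ks)"

lemma killed_append: "killed ks \<Longrightarrow> killed (ks @ ks')"
  by (simp add: killed_def dead_append)

text \<open>Being killed refers to all degrees \<open>s\<close> at once, so when
  \<open>1 + k\<close> has the inverse \<open>j\<close>, the tail may be judged after rescaling its
  letters by \<open>j\<close>.\<close>

lemma killed_Cons:
  assumes "killed (map ((*) j) ks)" "(1 + k) * j = 1"
  shows "killed (k # ks)"
proof -
  have "map ((*) (1 + k)) (map ((*) j) ks) = ks"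
    by (simp add: comp_def assms(2) flip: mult.assoc)
  then show ?thesis
    using assms(1) dead_Cons[of k _ "map ((*) j) ks"] unfolding killed_def by metis
qed

lemma killed_swap:
  "killed (pre @ l # k # post) \<Longrightarrow> killed (pre @ (k + l) # post) \<Longrightarrow> killed (pre @ k # l # post)"
  by (simp add: killed_def dead_swap)

lemma killed_sum: "1 + sum_list ks = 0 \<Longrightarrow> killed ks"
  by (simp add: killed_def dead_sum)

text \<open>A nonzero \<open>s\<close> is a unit, so every degree is a multiple of \<open>s\<close>
  and any homogeneous factors spell a word relative to \<open>s\<close>. For \<open>s = 0\<close>
  the module element itself already lies in \<open>Z\<close>.\<close>

lemma long_words_dead:
  assumes killed: "\<And>ks. length ks = b \<Longrightarrow> killed ks"
    and units: "\<And>s :: 'n. s \<noteq> 0 \<Longrightarrow> \<exists>t. s * t = 1"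
    and u: "u \<in> M s" and xs: "set xs \<subseteq> (\<Union>i. L i)" "b \<le> length xs"
  shows "foldl (*) u xs \<in> Z"
proof (cases "s = 0")
  case True
  then show ?thesis using u M_zero by (auto intro: foldl_Z)
next
  case False
  then obtain t where t: "s * t = 1" using units by blast
  have "\<exists>ks. list_all2 (\<lambda>x k. x \<in> L (k * s)) xs ks"
    using xs(1)
  proof (induction xs)
    case (Cons x xs)
    then obtain ks i where "list_all2 (\<lambda>x k. x \<in> L (k * s)) xs ks" "x \<in> L i" by auto
    moreover have "i * t * s = i" using t by (simp add: mult.assoc mult.commute[of t])
    ultimately have "list_all2 (\<lambda>x k. x \<in> L (k * s)) (x # xs) (i * t # ks)" by simp
    then show ?case by blast
  qed auto
  then obtain ks where ks: "list_all2 (\<lambda>x k. x \<in> L (k * s)) xs ks" by blast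
  then have "b \<le> length ks" using xs(2) by (simp add: list_all2_lengthD)
  then have "killed (take b ks @ drop b ks)" by (intro killed_append killed) simp
  then show ?thesis using u ks by (auto simp: killed_def dead_def)
qed

end

section \<open>Words over the integers modulo five\<close>

lemma mod5: "(5::5) = 0" "(6::5) = 1" "(7::5) = 2" "(8::5) = 3" "(9::5) = 4" "(10::5) = 0" "(12::5) = 2" "(16::5) = 1"
  by simp_all

locale graded_action5 = graded_action M L Z for M L :: "5 \<Rightarrow> 'r::ring set" and Z
begin

text \<open>The letter 0 is an acting element of degree zero. In the other four cases the leading
  letters, together with the 1 of the module element, add up to 5.\<close>

lemma killed_simps [simp]:
  "killed (0 # w)" "killed (4 # w)" "killed (1 # 3 # w)" "killed (2 # 2 # w)" "killed (3 # 1 # w)"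
  using killed_append[of "[0]" w] killed_append[of "[4]" w] killed_append[of "[1,3]" w]
    killed_append[of "[2,2]" w] killed_append[of "[3,1]" w]
  by (simp_all add: killed_sum mod5) (simp add: killed_def dead_zero)

text \<open>The factors 3, 2, 4 are the inverses of 2, 3, 4 modulo five. The first letters 0 and 4
  are killed outright, so these rules treat every remaining first letter.\<close>

lemma killed_rescale [simp]:
  "killed (map ((*) 3) w) \<Longrightarrow> killed (1 # w)"
  "killed (map ((*) 2) w) \<Longrightarrow> killed (2 # w)"
  "killed (map ((*) 4) w) \<Longrightarrow> killed (3 # w)"
  by (rule killed_Cons[of 3], simp_all add: mod5) (rule killed_Cons[of 2] killed_Cons[of 4], simp_all add: mod5)+

text \<open>The remaining rules are the minimal killed words, each obtained by exchanging two adjacent letters.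
  They were found by a saturation search.\<close>

lemmas killed_swap0 = killed_swap[of "[]", simplified]
lemmas killed_swap1 = killed_swap[of "[k]" for k, simplified]
lemmas killed_swap2 = killed_swap[of "[k,k']" for k k', simplified]

lemma killed_14 [simp]: "killed (1 # 4 # w)"
  by (rule killed_swap0) (simp_all add: mod5)

lemma killed_113 [simp]: "killed (1 # 1 # 3 # w)"
  by (rule killed_swap1) (simp_all add: mod5)

lemma killed_114 [simp]: "killed (1 # 1 # 4 # w)"
  by (rule killed_swap1) (simp_all add: mod5)

lemma killed_244 [simp]: "killed (2 # 4 # 4 # w)"
  by (rule killed_swap0) (simp_all add: mod5)

lemma killed_322 [simp]: "killed (3 # 2 # 2 # w)"
  by (rule killed_swap0) (simp_all add: mod5)

lemma killed_1112 [simp]: "killed (1 # 1 # 1 # 2 # w)"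
  by (rule killed_swap2) (simp_all add: mod5)

lemma killed_1113 [simp]: "killed (1 # 1 # 1 # 3 # w)"
  by (rule killed_swap2) (simp_all add: mod5)

lemma killed_1114 [simp]: "killed (1 # 1 # 1 # 4 # w)"
  by (rule killed_swap2) (simp_all add: mod5)

lemma killed_1222 [simp]: "killed (1 # 2 # 2 # 2 # w)"
  by (rule killed_swap0) (simp_all add: mod5)

lemma killed_1243 [simp]: "killed (1 # 2 # 4 # 3 # w)"
  by (rule killed_swap1) (simp_all add: mod5)

lemma killed_1244 [simp]: "killed (1 # 2 # 4 # 4 # w)"
  by (rule killed_swap1) (simp_all add: mod5)

lemma killed_2134 [simp]: "killed (2 # 1 # 3 # 4 # w)"
  by (rule killed_swap1) (simp_all add: mod5)

lemma killed_2333 [simp]: "killed (2 # 3 # 3 # 3 # w)"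
  by (rule killed_swap0) (simp_all add: mod5)

lemma killed_2413 [simp]: "killed (2 # 4 # 1 # 3 # w)"
  by (rule killed_swap0) (simp_all add: mod5)

lemma killed_2414 [simp]: "killed (2 # 4 # 1 # 4 # w)"
  by (rule killed_swap0) (simp_all add: mod5)

lemma killed_3232 [simp]: "killed (3 # 2 # 3 # 2 # w)"
  by (rule killed_swap0) (simp_all add: mod5)

lemma killed_3234 [simp]: "killed (3 # 2 # 3 # 4 # w)"
  by (rule killed_swap0) (simp_all add: mod5)

lemma killed_3322 [simp]: "killed (3 # 3 # 2 # 2 # w)"
  by (rule killed_swap1) (simp_all add: mod5)

lemma killed_3324 [simp]: "killed (3 # 3 # 2 # 4 # w)"
  by (rule killed_swap1) (simp_all add: mod5)

lemma killed_3342 [simp]: "killed (3 # 3 # 4 # 2 # w)"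
  by (rule killed_swap1) (simp_all add: mod5)

lemma killed_3444 [simp]: "killed (3 # 4 # 4 # 4 # w)"
  by (rule killed_swap0) (simp_all add: mod5)

lemma killed_2143 [simp]: "killed (2 # 1 # 4 # 3 # w)"
  by (rule killed_swap1) (simp_all add: mod5)

lemma killed_2144 [simp]: "killed (2 # 1 # 4 # 4 # w)"
  by (rule killed_swap1) (simp_all add: mod5)

lemma killed_21313 [simp]: "killed (2 # 1 # 3 # 1 # 3 # w)"
  by (rule killed_swap1) (simp_all add: mod5)

lemma killed_21314 [simp]: "killed (2 # 1 # 3 # 1 # 4 # w)"
  by (rule killed_swap1) (simp_all add: mod5)

lemma killed_24243 [simp]: "killed (2 # 4 # 2 # 4 # 3 # w)"
  by (rule killed_swap0) (simp_all add: mod5)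

lemma killed_24244 [simp]: "killed (2 # 4 # 2 # 4 # 4 # w)"
  by (rule killed_swap0) (simp_all add: mod5)

lemma killed_32122 [simp]: "killed (3 # 2 # 1 # 2 # 2 # w)"
  by (rule killed_swap0) (simp_all add: mod5)

lemma killed_32124 [simp]: "killed (3 # 2 # 1 # 2 # 4 # w)"
  by (rule killed_swap0) (simp_all add: mod5)

lemma killed_33432 [simp]: "killed (3 # 3 # 4 # 3 # 2 # w)"
  by (rule killed_swap1) (simp_all add: mod5)

lemma killed_33434 [simp]: "killed (3 # 3 # 4 # 3 # 4 # w)"
  by (rule killed_swap1) (simp_all add: mod5)

text \<open>One level of a search through the tree of words: below a prefix all five letters are
  tried, and a branch ends as soon as its prefix is killed.\<close>

lemma all_killed_Suc:
  assumes "\<And>k. k \<in> {0, 1, 2, 3, 4} \<Longrightarrow> killed (ks @ [k]) \<or> (\<forall>ks'. length ks' = n \<longrightarrow> killed ((ks @ [k]) @ ks'))"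
  shows "\<forall>ks'. length ks' = Suc n \<longrightarrow> killed (ks @ ks')"
proof (intro allI impI)
  fix ks' :: "5 list" assume "length ks' = Suc n"
  then obtain k ks'' where *: "ks' = k # ks''" "length ks'' = n"
    by (cases ks') auto
  obtain z where "k = of_int z" "0 \<le> z" "z < 5"
    by (cases k rule: bit1.cases) auto
  moreover from this have "z = 0 \<or> z = 1 \<or> z = 2 \<or> z = 3 \<or> z = 4" by auto
  ultimately have "k \<in> {0, 1, 2, 3, 4}" by auto
  then show "killed (ks @ ks')"
    using assms[of k] killed_append[of "ks @ [k]" ks''] * by auto
qed

lemma length_six_killed: "length ks = 6 \<Longrightarrow> killed ks"
proof -
  have "\<forall>ks'. length ks' = Suc (Suc (Suc (Suc (Suc (Suc 0))))) \<longrightarrow> killed ([] @ ks')"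
    \<comment> \<open>Each round closes the branches whose prefix \<open>simp\<close> recognises as
      killed; \<open>disjI2\<close> passes the others on to the next letter.\<close>
    by ((rule all_killed_Suc, elim insertE emptyE; hypsubst;
        ((rule disjI1, simp add: mod5; fail) | rule disjI2))+)
  then show "length ks = 6 \<Longrightarrow> killed ks" by (simp add: numeral_eq_Suc)
qed

end

section \<open>Words over the integers modulo three\<close>

locale graded_action3 = graded_action M L Z for M L :: "3 \<Rightarrow> 'r::ring set" and Z
begin

lemma length_two_killed: "length ks = 2 \<Longrightarrow> killed ks"
proof -
  assume "length ks = 2"
  then obtain k l where ks: "ks = [k, l]"
    by (auto simp: length_Suc_conv numeral_2_eq_2)
  have *: "i = 0 \<or> i = 1 \<or> i = 2" for i :: 3
  proof -
    obtain z where "i = of_int z" "0 \<le> z" "z < 3" by (cases i rule: bit1.cases) auto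
    moreover from this have "z = 0 \<or> z = 1 \<or> z = 2" by auto
    ultimately show ?thesis by auto
  qed
  have 0: "killed (0 # w)" for w using killed_append[of "[0]" w] by (simp add: killed_def dead_zero)
  have 2: "killed (2 # w)" for w using killed_append[of "[2]" w] by (simp add: killed_sum)
  have 3: "(3 :: 3) = 0" by simp
  have "killed [1, 0]" by (rule killed_Cons[of 2]) (simp_all add: 0)
  moreover have "killed [1, 1]" by (rule killed_sum) simp
  \<comment> \<open>The exchange leaves \<open>[2, 1]\<close> and \<open>[1 + 2]\<close>, which
    start with the killed letters 2 and 0.\<close>
  moreover have "killed [1, 2]" using killed_swap[of "[]" 2 1 "[]"] 0 2 by (simp add: 3)
  ultimately show ?thesis using *[of k] *[of l] 0 2 by (auto simp: ks)
qed

end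

section \<open>Central filtrations and polynomial sequences\<close>

context group
begin

definition comm :: "'a \<Rightarrow> 'a \<Rightarrow> 'a" where
  "comm x y = inv x \<otimes> inv y \<otimes> x \<otimes> y"

lemma inv_mult_cancel [simp]:
  "x \<in> carrier G \<Longrightarrow> y \<in> carrier G \<Longrightarrow> inv x \<otimes> (x \<otimes> y) = y"
  "x \<in> carrier G \<Longrightarrow> y \<in> carrier G \<Longrightarrow> x \<otimes> (inv x \<otimes> y) = y"
  by (simp_all flip: m_assoc)

lemmas word_simps = m_assoc inv_mult_group

lemma comm_closed [simp]: "x \<in> carrier G \<Longrightarrow> y \<in> carrier G \<Longrightarrow> comm x y \<in> carrier G"
  by (simp add: comm_def)

lemma comm_one [simp]: "x \<in> carrier G \<Longrightarrow> comm x \<one> = \<one>" "x \<in> carrier G \<Longrightarrow> comm \<one> x = \<one>"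
  by (simp_all add: comm_def)

lemma comm_conj: "x \<in> carrier G \<Longrightarrow> y \<in> carrier G \<Longrightarrow> x \<otimes> comm x y = inv y \<otimes> x \<otimes> y"
  by (simp add: comm_def word_simps)

lemma comm_eq_one: "x \<in> carrier G \<Longrightarrow> y \<in> carrier G \<Longrightarrow> comm x y = \<one> \<longleftrightarrow> x \<otimes> y = y \<otimes> x"
  by (metis comm_closed comm_conj inv_closed inv_mult_cancel(2) l_cancel_one' m_assoc m_closed r_one)

lemma comm_mult_left:
  assumes "x \<in> carrier G" "y \<in> carrier G" "z \<in> carrier G"
  shows "comm (x \<otimes> y) z = comm x z \<otimes> comm (comm x z) y \<otimes> comm y z"
  using assms by (simp add: comm_def word_simps)

lemma comm_mult_right:
  assumes "x \<in> carrier G" "y \<in> carrier G" "z \<in> carrier G"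
  shows "comm x (y \<otimes> z) = comm x z \<otimes> comm x y \<otimes> comm (comm x y) z"
  using assms by (simp add: comm_def word_simps)

lemma inv_comm: "x \<in> carrier G \<Longrightarrow> y \<in> carrier G \<Longrightarrow> inv (comm x y) = comm y x"
  by (simp add: comm_def word_simps)

end

text \<open>\<open>N_comm\<close> with \<open>j = 0\<close> makes every term normal, and with
  \<open>j = 1\<close> it makes the series central.\<close>

locale central_filtration = group G for G (structure) +
  fixes N :: "nat \<Rightarrow> 'a set"
  assumes N_subgroup: "subgroup (N i) G"
    and N_Suc: "N (Suc i) \<subseteq> N i"
    and N_0: "N 0 = carrier G" and N_1: "N 1 = carrier G"
    and N_comm: "x \<in> N i \<Longrightarrow> y \<in> N j \<Longrightarrow> comm x y \<in> N (i + j)"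
begin

lemma N_carrier: "x \<in> N i \<Longrightarrow> x \<in> carrier G"
  using N_subgroup subgroup.mem_carrier by metis

lemma N_closed: "\<one> \<in> N i" "x \<in> N i \<Longrightarrow> y \<in> N i \<Longrightarrow> x \<otimes> y \<in> N i" "x \<in> N i \<Longrightarrow> inv x \<in> N i"
  using N_subgroup[of i] by (auto intro: subgroup.one_closed subgroup.m_closed subgroup.m_inv_closed)

lemma N_mono: "i \<le> j \<Longrightarrow> N j \<subseteq> N i"
  using N_Suc lift_Suc_antimono_le[of N] by auto

lemma N_monoD: "x \<in> N j \<Longrightarrow> i \<le> j \<Longrightarrow> x \<in> N i"
  using N_mono by auto

lemma N_conj: "x \<in> N i \<Longrightarrow> y \<in> carrier G \<Longrightarrow> inv y \<otimes> x \<otimes> y \<in> N i"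
  using N_comm[of x i y 0] N_closed(2)[of x i "comm x y"] comm_conj[of x y] N_carrier N_0 by auto

section \<open>Polynomial sequences in a filtered group\<close>

definition \<Delta> :: "(nat \<Rightarrow> 'a) \<Rightarrow> nat \<Rightarrow> 'a" where
  "\<Delta> f n = inv (f n) \<otimes> f (Suc n)"

text \<open>\<open>tpoly r d f\<close>: the \<open>j\<close>-th difference of \<open>f\<close> takes values in \<open>N (d + j)\<close> for all \<open>j \<le> r\<close>.
  Truncating at \<open>r\<close> turns the Lazard--Leibman closure theorem into a simple induction on \<open>r\<close>: the difference
  of \<open>[f, g]\<close> involves \<open>[f, g]\<close> itself, but only to lower order.\<close>
primrec tpoly :: "nat \<Rightarrow> nat \<Rightarrow> (nat \<Rightarrow> 'a) \<Rightarrow> bool" where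
  "tpoly 0 d f \<longleftrightarrow> (\<forall>n. f n \<in> N d)"
| "tpoly (Suc r) d f \<longleftrightarrow> (\<forall>n. f n \<in> N d) \<and> tpoly r (Suc d) (\<Delta> f)"

lemma tpoly_range: "tpoly r d f \<Longrightarrow> f n \<in> N d"
  by (cases r) auto

lemma tpoly_carrier: "tpoly r d f \<Longrightarrow> f n \<in> carrier G"
  using tpoly_range N_carrier by blast

lemma tpoly_mono: "tpoly r d f \<Longrightarrow> e \<le> d \<Longrightarrow> tpoly r e f"
  by (induction r arbitrary: d e f) (auto intro: N_monoD)

lemma tpoly_Suc: "tpoly (Suc r) d f \<Longrightarrow> tpoly r d f"
  by (induction r arbitrary: d f) auto

lemma tpoly_shift: "tpoly r d f \<Longrightarrow> tpoly r d (\<lambda>n. f (Suc n))"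
proof (induction r arbitrary: d f)
  case (Suc r)
  have "\<Delta> (\<lambda>n. f (Suc n)) = (\<lambda>n. \<Delta> f (Suc n))"
    by (simp add: \<Delta>_def fun_eq_iff)
  with Suc show ?case by auto
qed auto

lemma \<Delta>_mult:
  assumes "\<And>n. f n \<in> carrier G" "\<And>n. g n \<in> carrier G"
  shows "\<Delta> (\<lambda>n. f n \<otimes> g n) = (\<lambda>n. \<Delta> f n \<otimes> comm (\<Delta> f n) (g n) \<otimes> \<Delta> g n)"
  using assms by (simp add: fun_eq_iff \<Delta>_def comm_def word_simps)

lemma \<Delta>_inv:
  assumes "\<And>n. f n \<in> carrier G"
  shows "\<Delta> (\<lambda>n. inv (f n)) = (\<lambda>n. inv (\<Delta> f n) \<otimes> comm (inv (\<Delta> f n)) (inv (f n)))"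
  using assms by (simp add: fun_eq_iff \<Delta>_def comm_def word_simps)

text \<open>Expanding \<open>g (Suc n)\<close> and then \<open>f (Suc n)\<close> gives \<open>c (Suc
  n) = y n \<otimes> (c n \<otimes> k n) \<otimes> comm (c n \<otimes> k n) (\<Delta> g n)\<close>.
  Conjugating \<open>y n\<close> by \<open>c n\<close> produces the factor
  \<open>comm (y n) (c n)\<close>.\<close>

lemma \<Delta>_comm:
  assumes "\<And>n. f n \<in> carrier G" "\<And>n. g n \<in> carrier G"
  defines "y \<equiv> \<lambda>n. comm (f (Suc n)) (\<Delta> g n)"
    and "c \<equiv> \<lambda>n. comm (f n) (g n)"
    and "k \<equiv> \<lambda>n. comm (comm (f n) (g n)) (\<Delta> f n) \<otimes> comm (\<Delta> f n) (g n)"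
  shows "\<Delta> c = (\<lambda>n. y n \<otimes> comm (y n) (c n) \<otimes> (k n \<otimes> comm (c n \<otimes> k n) (\<Delta> g n)))"
  using assms(1,2) by (simp add: fun_eq_iff y_def c_def k_def \<Delta>_def comm_def word_simps)

text \<open>The three closures need each other: differences of products and inverses contain
  commutators, and the difference of a commutator is a product of such terms. Commuting with any
  further sequence never loses depth.\<close>

lemma tpoly_closed:
  shows "tpoly r d f \<Longrightarrow> tpoly r d g \<Longrightarrow> tpoly r d (\<lambda>n. f n \<otimes> g n)"
    and "tpoly r d f \<Longrightarrow> tpoly r d (\<lambda>n. inv (f n))"
    and "tpoly r d f \<Longrightarrow> tpoly r e g \<Longrightarrow> tpoly r (d + e) (\<lambda>n. comm (f n) (g n))"
proof (induction r arbitrary: d e f g)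
  case 0
  { case 1 then show ?case by (simp add: N_closed) }
  { case 2 then show ?case by (simp add: N_closed) }
  { case 3 then show ?case by (simp add: N_comm) }
next
  case (Suc r)
  note mult = Suc.IH(1) and inv = Suc.IH(2) and comm = Suc.IH(3)
  { case 1
    note car = tpoly_carrier[OF 1(1)] tpoly_carrier[OF 1(2)]
    have "tpoly r (Suc d) (\<lambda>n. comm (\<Delta> f n) (g n))"
      using comm[of "Suc d" "\<Delta> f" d g] 1 tpoly_Suc by (auto intro: tpoly_mono)
    then show ?case
      using 1 car by (auto simp: \<Delta>_mult intro!: mult N_closed) }
  { case 2
    note car = tpoly_carrier[OF 2]
    have "tpoly r (Suc d) (\<lambda>n. inv (\<Delta> f n))" "tpoly r d (\<lambda>n. inv (f n))"
      using inv 2 tpoly_Suc by auto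
    moreover from comm[OF this]
    have "tpoly r (Suc d) (\<lambda>n. comm (inv (\<Delta> f n)) (inv (f n)))"
      by (rule tpoly_mono) simp
    ultimately show ?case
      using 2 car by (auto simp: \<Delta>_inv intro!: mult N_closed) }
  { case 3
    note car = tpoly_carrier[OF 3(1)] tpoly_carrier[OF 3(2)]
    define u v c where "u = \<Delta> f" and "v = \<Delta> g" and "c = (\<lambda>n. comm (f n) (g n))"
    define y k where "y = (\<lambda>n. comm (f (Suc n)) (v n))" and "k = (\<lambda>n. comm (c n) (u n) \<otimes> comm (u n) (g n))"
    have f: "tpoly r d f" and g: "tpoly r e g" and u: "tpoly r (Suc d) u" and v: "tpoly r (Suc e) v"
      using 3 by (auto simp: u_def v_def intro: tpoly_Suc)
    have c: "tpoly r (d + e) c"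
      unfolding c_def by (rule comm[OF f g])
    have y: "tpoly r (Suc (d + e)) y"
      using comm[OF tpoly_shift[OF f] v] by (simp add: y_def)
    have k: "tpoly r (Suc (d + e)) k"
      unfolding k_def using comm[OF c u] comm[OF u g] by (intro mult) (auto intro: tpoly_mono)
    have "tpoly r (Suc (d + e)) (\<lambda>n. comm (y n) (c n))"
      using comm[OF y c] by (rule tpoly_mono) simp
    moreover have "tpoly r (Suc (d + e)) (\<lambda>n. comm (c n \<otimes> k n) (v n))"
      by (rule tpoly_mono[OF comm[OF mult[OF c tpoly_mono[OF k]] v]]) auto
    ultimately have "tpoly r (Suc (d + e)) (\<lambda>n. y n \<otimes> comm (y n) (c n) \<otimes> (k n \<otimes> comm (c n \<otimes> k n) (v n)))"
      using y k mult by auto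
    also have "(\<lambda>n. y n \<otimes> comm (y n) (c n) \<otimes> (k n \<otimes> comm (c n \<otimes> k n) (v n))) = \<Delta> c"
      using \<Delta>_comm[OF car] by (simp add: y_def c_def k_def u_def v_def)
    finally show ?case
      using c tpoly_range by (auto simp: c_def) }
qed

lemma \<Delta>_const: "a \<in> carrier G \<Longrightarrow> \<Delta> (\<lambda>n. a) = (\<lambda>n. \<one>)"
  by (simp add: \<Delta>_def fun_eq_iff)

lemma tpoly_one: "tpoly r d (\<lambda>n. \<one>)"
  by (induction r arbitrary: d) (auto simp: \<Delta>_const N_closed)

lemma N_pow: "a \<in> N d \<Longrightarrow> a [^] (n::nat) \<in> N d"
  by (induction n) (auto simp: N_closed)

text \<open>By Pascal's rule, taking the difference lowers \<open>j\<close> by one while the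
  required depth \<open>d\<close> grows by one, so \<open>d + j\<close> is preserved.\<close>

lemma tpoly_pow: "a \<in> N (d + j) \<Longrightarrow> tpoly r d (\<lambda>n. a [^] (n choose j))"
proof (induction r arbitrary: d j)
  case 0
  then show ?case by (auto intro: N_pow N_monoD)
next
  case (Suc r)
  have a: "a \<in> carrier G" using Suc.prems N_carrier by auto
  have "tpoly r (Suc d) (\<Delta> (\<lambda>n. a [^] (n choose j)))"
  proof (cases j)
    case 0
    then show ?thesis using a tpoly_one by (simp add: \<Delta>_const)
  next
    case (Suc j')
    have "\<Delta> (\<lambda>n. a [^] (n choose j)) = (\<lambda>n. a [^] (n choose j'))"
      using a by (simp add: Suc \<Delta>_def fun_eq_iff add.commute[of "_ choose j'"] nat_pow_mult[symmetric])
    then show ?thesis using Suc.IH[of "Suc d" j'] Suc.prems Suc by simp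
  qed
  moreover have "a [^] (n choose j) \<in> N d" for n
    using Suc.prems by (auto intro: N_pow N_monoD)
  ultimately show ?case by simp
qed

definition poly_seq :: "(nat \<Rightarrow> 'a) \<Rightarrow> bool" where
  "poly_seq f \<longleftrightarrow> (\<forall>r. tpoly r 0 f)"

text \<open>If all earlier values are trivial, the \<open>j\<close>-th difference at 0 is
  \<open>f j\<close> itself.\<close>

lemma poly_seq_first_value:
  assumes "poly_seq f" "\<And>i. i < j \<Longrightarrow> f i = \<one>"
  shows "f j \<in> N j"
proof -
  \<comment> \<open>Here \<open>g\<close> stands for the \<open>i\<close>-th difference of
    \<open>f\<close>, in which the first possibly nontrivial value \<open>f j\<close> has moved to
    position \<open>j - i\<close>.\<close>
  have gen: "f j \<in> N (d + j - i)"
    if "tpoly (j - i) d g" "\<And>n. n + i < j \<Longrightarrow> g n = \<one>" "g (j - i) = f j" "i \<le> j" for i d g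
    using that
  proof (induction "j - i" arbitrary: i d g)
    case 0
    then have "i = j" "g 0 = f j" by auto
    then show ?case using tpoly_range[OF 0(2), of 0] by simp
  next
    case (Suc m)
    then have m: "j - Suc i = m" "j - i = Suc m" by auto
    have "f j \<in> N (Suc d + j - Suc i)"
    proof (rule Suc.hyps(1)[of "Suc i" "Suc d" "\<Delta> g"])
      show "tpoly (j - Suc i) (Suc d) (\<Delta> g)"
        using Suc.prems(1) m by simp
      show "\<Delta> g n = \<one>" if "n + Suc i < j" for n
        using Suc.prems(2)[of n] Suc.prems(2)[of "Suc n"] that by (simp add: \<Delta>_def)
      have "g (j - Suc i) = \<one>" "Suc (j - Suc i) = j - i"
        using Suc.prems(2)[of "j - Suc i"] Suc.hyps(2) by auto
      then show "\<Delta> g (j - Suc i) = f j"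
        using Suc.prems(3) tpoly_carrier[OF Suc.prems(1)] by (metis \<Delta>_def inv_one l_one)
    qed (use Suc.hyps(2) in auto)
    then show ?case by simp
  qed
  from gen[of 0 0 f] show ?thesis
    using assms unfolding poly_seq_def by simp
qed

text \<open>If all values lie in a subgroup of prime exponent \<open>q\<close> then the Taylor coefficients
  \<open>a\<^sub>j\<close> with \<open>2 \<le> j < q\<close> contribute \<open>a\<^sub>j\<close> to the power \<open>q choose j\<close>, which is trivial.\<close>
lemma poly_seq_prime_value:
  assumes f: "poly_seq f" and f01: "f 0 = \<one>" "f 1 = \<one>"
    and q: "Factorial_Ring.prime (q::nat)" and Nq: "N q = {\<one>}"
    and D: "subgroup D G" "\<And>x. x \<in> D \<Longrightarrow> x [^] q = \<one>" and fD: "\<And>n. f n \<in> D"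
  shows "f q = \<one>"
proof -
  \<comment> \<open>One Taylor factor is removed at a time. Each is trivial at \<open>q\<close>, so
    \<open>f q\<close> survives until all earlier values are trivial and it is forced into
    \<open>N q\<close>.\<close>
  have "\<exists>g. poly_seq g \<and> (\<forall>i<j. g i = \<one>) \<and> (\<forall>n. g n \<in> D) \<and> g q = f q" if "2 \<le> j" "j \<le> q" for j
    using that
  proof (induction j rule: dec_induct)
    case base
    have "\<forall>i<2. f i = \<one>" using f01 by (simp add: numeral_2_eq_2 less_Suc_eq)
    then show ?case using f fD by blast
  next
    case (step j)
    then obtain g where g: "poly_seq g" "\<forall>i<j. g i = \<one>" "\<forall>n. g n \<in> D" "g q = f q" by auto
    define a where "a = g j"
    define g' where "g' = (\<lambda>n. inv (a [^] (n choose j)) \<otimes> g n)"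
    have aN: "a \<in> N j" unfolding a_def by (rule poly_seq_first_value) (use g in auto)
    have a: "a \<in> carrier G" "a \<in> D" using aN N_carrier g(3) by (auto simp: a_def)
    have car: "g n \<in> carrier G" for n
      using g(1) tpoly_carrier unfolding poly_seq_def by blast
    have "poly_seq g'"
      unfolding poly_seq_def g'_def using g(1) aN
      by (auto simp: poly_seq_def intro!: tpoly_closed(1,2) tpoly_pow)
    moreover have "g' i = \<one>" if "i < Suc j" for i
      using that g(2) a car by (auto simp: g'_def less_Suc_eq a_def binomial_eq_0)
    moreover have "a [^] n \<in> D" for n :: nat
      using D(1) a by (induction n) (auto intro: subgroup.one_closed subgroup.m_closed)
    then have "g' n \<in> D" for n
      using D(1) g(3) by (auto simp: g'_def intro: subgroup.m_closed subgroup.m_inv_closed)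
    moreover have "g' q = f q"
    proof -
      have "q dvd (q choose j)" using step.hyps step.prems q
        by (intro dvd_choose_prime) auto
      then obtain m where "q choose j = q * m" by auto
      then have "a [^] (q choose j) = \<one>" using a D(2) by (simp add: nat_pow_pow[symmetric])
      then show ?thesis using car[of q] g(4) by (simp add: g'_def)
    qed
    ultimately show ?case by auto
  qed
  from this[of q] obtain g where "poly_seq g" "\<forall>i<q. g i = \<one>" "g q = f q"
    using prime_ge_2_nat[OF q] by auto
  with poly_seq_first_value[of g q] Nq show ?thesis by auto
qed


text \<open>Take \<open>h\<close> in the deepest term \<open>N i\<close> where \<open>h\<^sup>q \<noteq> 1\<close> is possible; then \<open>h\<^sup>-\<^sup>n x\<^sup>-\<^sup>n (x h)\<^sup>n\<close> is a polynomial
  sequence with values in \<open>H \<inter> N (i + 1)\<close>, which has exponent \<open>q\<close>.\<close>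
lemma exponent_prime:
  assumes q: "Factorial_Ring.prime (q::nat)" and Nq: "N q = {\<one>}"
    and H: "H \<lhd> G" "H \<noteq> carrier G" and out: "\<And>x. x \<in> carrier G - H \<Longrightarrow> x [^] q = \<one>"
    and h: "h \<in> H"
  shows "h [^] q = \<one>"
proof (rule ccontr)
  interpret H: normal H G by (rule H(1))
  assume "h [^] q \<noteq> \<one>"
  define P where "P i \<longleftrightarrow> (\<exists>h\<in>H \<inter> N i. h [^] q \<noteq> \<one>)" for i
  have P1: "P 1" using h \<open>h [^] q \<noteq> \<one>\<close> H.mem_carrier unfolding P_def N_1 by blast
  have bound: "i \<le> q" if "P i" for i
  proof (rule ccontr)
    assume "\<not> i \<le> q"
    then have "N i \<subseteq> {\<one>}" using N_mono[of q i] Nq by auto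
    with that show False by (auto simp: P_def)
  qed
  define i where "i = (GREATEST i. P i)"
  have "P i" and top: "\<And>j. P j \<Longrightarrow> j \<le> i"
    unfolding i_def using GreatestI_nat[of P] Greatest_le_nat[of P] P1 bound by blast+
  then obtain h where h: "h \<in> H" "h \<in> N i" "h [^] q \<noteq> \<one>" by (auto simp: P_def)
  obtain x where x: "x \<in> carrier G" "x \<notin> H" using H(2) H.subset by auto
  have hc: "h \<in> carrier G" using h by auto
  define D where "D = H \<inter> N (Suc i)"
  have D: "subgroup D G" unfolding D_def
    by (rule subgroups_Inter_pair) (auto intro: N_subgroup H.subgroup_axioms)
  have Dq: "d [^] q = \<one>" if "d \<in> D" for d
  proof (rule ccontr)
    assume "d [^] q \<noteq> \<one>"
    then have "P (Suc i)" using that by (auto simp: P_def D_def)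
    then show False using top by force
  qed
  have Dconj: "inv y \<otimes> d \<otimes> y \<in> D" if "d \<in> D" "y \<in> carrier G" for d y
    using that H.inv_op_closed1 N_conj by (auto simp: D_def)
  define f where "f n = inv (h [^] n) \<otimes> (inv (x [^] n) \<otimes> (x \<otimes> h) [^] n)" for n :: nat
  have "poly_seq f"
  proof -
    have "tpoly r 0 (\<lambda>n. a [^] n)" if "a \<in> carrier G" for a r
      using tpoly_pow[of a 0 1 r] that N_1 by simp
    then show ?thesis
      using x hc unfolding poly_seq_def f_def by (intro allI tpoly_closed(1,2)) auto
  qed
  moreover have "f n \<in> D" for n
  proof (induction n)
    case 0
    then show ?case using D by (auto simp: f_def subgroup.one_closed)
  next
    case (Suc n)
    define a b where "a = h [^] n" and "b = x [^] n"
    have ab: "a \<in> carrier G" "b \<in> carrier G" using x hc by (auto simp: a_def b_def)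
    have abS: "h [^] Suc n = a \<otimes> h" "x [^] Suc n = b \<otimes> x" by (simp_all add: a_def b_def)
    have a: "a \<in> H" "a \<in> N i"
      unfolding a_def using h by (induction n) (auto simp: N_closed)
    have "comm a x \<in> N (Suc i)" using N_comm[of a i x 1] a x N_1 by auto
    moreover have "comm a x \<in> H"
      using a(1) x H.inv_op_closed1[of x a] ab H.m_inv_closed H.m_closed
      by (simp add: comm_def m_assoc)
    ultimately have "comm a x \<in> D" by (simp add: D_def)
    have "(x \<otimes> h) [^] n = b \<otimes> a \<otimes> f n"
      using ab x hc by (simp add: f_def a_def b_def m_assoc)
    \<comment> \<open>Up to conjugation by \<open>x\<close> and \<open>h\<close>, passing from
      \<open>n\<close> to \<open>Suc n\<close> only adds the factor \<open>comm a x\<close>, which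
      is one term deeper than \<open>h\<close>.\<close>
    then have "f (Suc n) = inv h \<otimes> ((inv a \<otimes> inv x \<otimes> a \<otimes> x) \<otimes> (inv x \<otimes> f n \<otimes> x)) \<otimes> h"
      unfolding f_def[of "Suc n"] abS using ab x hc Suc subgroup.mem_carrier[OF D]
      by (simp add: word_simps)
    also have "inv a \<otimes> inv x \<otimes> a \<otimes> x = comm a x" by (simp add: comm_def)
    finally show ?case
      using \<open>comm a x \<in> D\<close> Suc x hc by (simp add: Dconj subgroup.m_closed[OF D])
  qed
  moreover have "f 0 = \<one>" "f 1 = \<one>"
    using x hc by (simp_all add: f_def word_simps)
  ultimately have "f q = \<one>"
    using poly_seq_prime_value[OF _ _ _ q Nq D Dq] by blast
  \<comment> \<open>Both \<open>x\<close> and \<open>x \<otimes> h\<close> lie outside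
    \<open>H\<close>, so at \<open>q\<close> the sequence \<open>f\<close> reduces to the inverse of
    \<open>h [^] q\<close>.\<close>
  moreover have "x \<otimes> h \<notin> H"
    using x h hc H.m_closed[of "x \<otimes> h" "inv h"] by (auto simp: m_assoc)
  then have "(x \<otimes> h) [^] q = \<one>" "x [^] q = \<one>" using out x hc by auto
  ultimately show False using h hc by (simp add: f_def)
qed

end

section \<open>The lower central series\<close>

context group
begin

text \<open>Indices start at zero, so \<open>lcs n\<close> is the term usually numbered n + 1, and
  \<open>lcs n = {\<one>}\<close> says that the class is at most \<open>n\<close>.\<close>

primrec lcs :: "nat \<Rightarrow> 'a set" where
  "lcs 0 = carrier G"
| "lcs (Suc n) = generate G {comm x y |x y. x \<in> lcs n \<and> y \<in> carrier G}"

declare lcs.simps(2) [simp del]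

lemma conj_comm:
  "x \<in> carrier G \<Longrightarrow> y \<in> carrier G \<Longrightarrow> g \<in> carrier G \<Longrightarrow>
    g \<otimes> comm x y \<otimes> inv g = comm (g \<otimes> x \<otimes> inv g) (g \<otimes> y \<otimes> inv g)"
  by (simp add: comm_def word_simps)

lemma lcs_normal: "lcs n \<lhd> G"
proof (induction n)
  case 0
  then show ?case by (simp add: normal_inv_iff subgroup_self)
next
  case (Suc n)
  interpret n: normal "lcs n" G by (rule Suc)
  have "{comm x y |x y. x \<in> lcs n \<and> y \<in> carrier G} \<subseteq> carrier G" using n.subset by auto
  moreover have "g \<otimes> z \<otimes> inv g \<in> {comm x y |x y. x \<in> lcs n \<and> y \<in> carrier G}"
    if "z \<in> {comm x y |x y. x \<in> lcs n \<and> y \<in> carrier G}" "g \<in> carrier G" for z g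
  proof -
    obtain x y where "z = comm x y" "x \<in> lcs n" "y \<in> carrier G" using \<open>z \<in> _\<close> by auto
    then show ?thesis
      using n.inv_op_closed2[of g x] conj_comm[of x y g] n.mem_carrier \<open>g \<in> carrier G\<close> by blast
  qed
  ultimately show ?case unfolding lcs.simps(2) by (rule normal_generateI)
qed

lemma lcs_carrier: "x \<in> lcs n \<Longrightarrow> x \<in> carrier G"
  using lcs_normal[of n] normal_imp_subgroup subgroup.mem_carrier by metis

lemma lcs_inv: "x \<in> lcs n \<Longrightarrow> inv x \<in> lcs n"
  using lcs_normal[of n] normal_imp_subgroup subgroup.m_inv_closed by metis

lemma comm_lcs: "x \<in> lcs n \<Longrightarrow> y \<in> carrier G \<Longrightarrow> comm x y \<in> lcs (Suc n)"
  by (auto simp: lcs.simps(2) intro!: generate.incl)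

lemma lcs_Suc_least:
  "subgroup P G \<Longrightarrow> (\<And>x y. x \<in> lcs n \<Longrightarrow> y \<in> carrier G \<Longrightarrow> comm x y \<in> P) \<Longrightarrow> lcs (Suc n) \<subseteq> P"
  unfolding lcs.simps(2) by (rule generate_subgroup_incl) auto

lemma lcs_Suc_subset: "lcs (Suc n) \<subseteq> lcs n"
proof (rule lcs_Suc_least)
  interpret n: normal "lcs n" G by (rule lcs_normal)
  show "subgroup (lcs n) G" by (rule n.subgroup_axioms)
  show "comm x y \<in> lcs n" if "x \<in> lcs n" "y \<in> carrier G" for x y
    using that n.inv_op_closed1[of y x] n.m_inv_closed[of x] n.mem_carrier
    by (simp add: comm_def m_assoc n.m_closed)
qed

lemma subgroup_middle:
  assumes "subgroup P G" "a \<otimes> b \<otimes> c = \<one>" "a \<in> P" "c \<in> P" "b \<in> carrier G"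
  shows "b \<in> P"
proof -
  interpret P: subgroup P G by fact
  have "b = inv a \<otimes> (a \<otimes> b \<otimes> c) \<otimes> inv c"
    using assms(3-) P.mem_carrier by (simp add: m_assoc)
  then show ?thesis using assms by auto
qed

lemma hall_witt:
  assumes "x \<in> carrier G" "y \<in> carrier G" "z \<in> carrier G"
  shows "(inv y \<otimes> comm (comm x (inv y)) z \<otimes> y) \<otimes> (inv z \<otimes> comm (comm y (inv z)) x \<otimes> z)
    \<otimes> (inv x \<otimes> comm (comm z (inv x)) y \<otimes> x) = \<one>"
  using assms by (simp add: comm_def word_simps)

text \<open>The three subgroups argument. Since \<open>P\<close> is normal, the elements whose
  commutators with \<open>lcs i\<close> all lie in \<open>P\<close> form a subgroup, so only the
  generators of \<open>lcs (Suc j)\<close> have to be tested; the Hall-Witt identity reduces them to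
  level \<open>j\<close>, with \<open>i\<close> and with \<open>Suc i\<close>.\<close>

lemma comm_lcs_lcs: "x \<in> lcs i \<Longrightarrow> y \<in> lcs j \<Longrightarrow> comm x y \<in> lcs (Suc (i + j))"
proof (induction j arbitrary: i x y)
  case 0
  then show ?case using comm_lcs by simp
next
  case (Suc j)
  define P where "P = lcs (Suc (i + Suc j))"
  interpret P: normal P G unfolding P_def by (rule lcs_normal)
  define T where "T = {w \<in> carrier G. \<forall>x\<in>lcs i. comm x w \<in> P}"
  have "subgroup T G"
  proof
    show "a \<otimes> b \<in> T" if "a \<in> T" "b \<in> T" for a b
    proof -
      have "comm x (a \<otimes> b) \<in> P" if x: "x \<in> lcs i" for x
      proof -
        have "comm x (a \<otimes> b) = comm x b \<otimes> (inv b \<otimes> comm x a \<otimes> b)"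
          using that \<open>a \<in> T\<close> \<open>b \<in> T\<close> lcs_carrier by (simp add: T_def comm_def word_simps)
        then show ?thesis
          using x \<open>a \<in> T\<close> \<open>b \<in> T\<close> P.inv_op_closed1 P.m_closed by (auto simp: T_def)
      qed
      then show ?thesis using that by (simp add: T_def)
    qed
    show "inv a \<in> T" if "a \<in> T" for a
    proof -
      have "comm x (inv a) \<in> P" if x: "x \<in> lcs i" for x
      proof -
        have "comm x (inv a) = a \<otimes> inv (comm x a) \<otimes> inv a"
          using that \<open>a \<in> T\<close> lcs_carrier by (simp add: T_def comm_def word_simps)
        then show ?thesis
          using x \<open>a \<in> T\<close> P.inv_op_closed2 P.m_inv_closed by (auto simp: T_def)
      qed
      then show ?thesis using that by (simp add: T_def)
    qed
  qed (auto simp: T_def lcs_carrier P.one_closed)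
  moreover have "comm a g \<in> T" if a: "a \<in> lcs j" and g: "g \<in> carrier G" for a g
  proof -
    have "comm x (comm a g) \<in> P" if x: "x \<in> lcs i" for x
    proof -
      have car: "x \<in> carrier G" "a \<in> carrier G" "g \<in> carrier G" "inv g \<in> carrier G"
        using a x g lcs_carrier by auto
      have "inv a \<in> lcs j" "inv x \<in> lcs i"
        using a x lcs_inv by auto
      then have "comm (comm x (inv a)) (inv g) \<in> P"
        using comm_lcs[OF Suc.IH[OF x] car(4)] by (simp add: P_def)
      then have A: "inv a \<otimes> comm (comm x (inv a)) (inv g) \<otimes> a \<in> P"
        using P.inv_op_closed1 car by simp
      have "comm (inv g) (inv x) = inv (comm (inv x) (inv g))" using car by (simp add: inv_comm)
      also have "\<dots> \<in> lcs (Suc i)"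
        using lcs_inv[OF comm_lcs[OF \<open>inv x \<in> lcs i\<close> car(4)]] .
      finally have "comm (comm (inv g) (inv x)) a \<in> P"
        using Suc.IH[of _ "Suc i"] a by (simp add: P_def)
      then have C: "inv x \<otimes> comm (comm (inv g) (inv x)) a \<otimes> x \<in> P"
        using P.inv_op_closed1 car by simp
      \<comment> \<open>Hall-Witt is applied to \<open>inv g\<close>, so that the inner commutator
        of its middle factor becomes \<open>comm a g\<close>.\<close>
      define B where "B = g \<otimes> comm (comm a g) x \<otimes> inv g"
      have "(inv a \<otimes> comm (comm x (inv a)) (inv g) \<otimes> a) \<otimes> B
          \<otimes> (inv x \<otimes> comm (comm (inv g) (inv x)) a \<otimes> x) = \<one>"
        using hall_witt[of x a "inv g"] car by (simp add: B_def)
      then have "B \<in> P"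
        using A C car by (auto simp: B_def intro: subgroup_middle[OF P.subgroup_axioms])
      then have "inv g \<otimes> B \<otimes> g \<in> P"
        using P.inv_op_closed1 car by simp
      then have "comm (comm a g) x \<in> P"
        using car by (simp add: B_def m_assoc)
      then show ?thesis
        using P.m_inv_closed inv_comm[of "comm a g" x] car by (metis comm_closed)
    qed
    then show ?thesis using a g lcs_carrier by (simp add: T_def)
  qed
  ultimately have "lcs (Suc j) \<subseteq> T" by (rule lcs_Suc_least)
  then show ?case using Suc.prems by (auto simp: T_def P_def)
qed

text \<open>Truncated subtraction makes the terms \<open>0\<close> and \<open>1\<close> of the filtration coincide, as they must.\<close>
lemma lcs_filtration: "central_filtration G (\<lambda>i. lcs (i - 1))"
proof (intro central_filtration.intro central_filtration_axioms.intro is_group)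
  show "comm x y \<in> lcs (i + j - 1)" if "x \<in> lcs (i - 1)" "y \<in> lcs (j - 1)" for x y i j
  proof (cases "i = 0 \<or> j = 0")
    case True
    then consider "i = 0" | "j = 0" by auto
    then show ?thesis
    proof cases
      case 1
      have "comm y x \<in> lcs (j - 1)"
        using comm_lcs[of y "j - 1" x] lcs_Suc_subset that 1 by (auto simp: lcs_carrier)
      then have "inv (comm y x) \<in> lcs (j - 1)"
        by (rule lcs_inv)
      then show ?thesis using 1 that lcs_carrier by (simp add: inv_comm)
    next
      case 2
      then show ?thesis
        using comm_lcs[of x "i - 1" y] lcs_Suc_subset that by (auto simp: lcs_carrier)
    qed
  next
    case False
    then show ?thesis using comm_lcs_lcs[OF that] by (cases i; cases j) auto
  qed
  show "lcs (Suc i - 1) \<subseteq> lcs (i - 1)" for i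
    using lcs_Suc_subset by (cases i) auto
  show "subgroup (lcs (i - 1)) G" for i
    using lcs_normal normal_imp_subgroup by blast
qed auto

end

section \<open>Noncommutative polynomials over a cyclic group ring\<close>

text \<open>Concatenation is written as addition because the product of finitely supported functions
  is convolution over an additive monoid.\<close>

datatype 'a free_word = Word (letters: "'a list")

instantiation free_word :: (type) monoid_add
begin
definition "0 = Word []"
definition "u + v = Word (letters u @ letters v)"
instance by standard (auto simp: zero_free_word_def plus_free_word_def)
end

text \<open>The ring \<open>\<int>[\<int>/n]\<langle>X\<rangle>\<close> of noncommutative polynomials: since \<open>'n\<close> is a monoid under addition,
  the second component of a monomial is an exponent of a central variable \<open>t\<close> with \<open>t\<^sup>n = 1\<close>.\<close>
type_synonym ('a, 'n) npoly = "('a free_word \<times> 'n) \<Rightarrow>\<^sub>0 int"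

abbreviation mon :: "'a list \<Rightarrow> 'n \<Rightarrow> ('a, 'n) npoly" where
  "mon w m \<equiv> frag_of (Word w, m)"

lemma mono_mult [simp]: "mon w m * mon w' m' = mon (w @ w') (m + m' :: 'n::monoid_add)"
  by (simp add: mult_single plus_free_word_def)

lemma mono_one: "mon [] 0 = (1 :: ('a, 'n::monoid_add) npoly)"
  by (simp flip: single_one add: zero_prod_def zero_free_word_def)

definition tee :: "'n \<Rightarrow> ('a, 'n) npoly" where
  "tee m = mon [] m"

lemma tee_mono [simp]: "tee l * mon w m = mon w (l + m :: 'n::monoid_add)"
  by (simp add: tee_def)

lemma npoly_induct [case_names zero mono diff]:
  fixes a :: "('a, 'n) npoly"
  assumes "P 0" "\<And>w m. P (mon w m)" "\<And>a b. P a \<Longrightarrow> P b \<Longrightarrow> P (a - b)"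
  shows "P a"
proof (rule frag_induction[of a UNIV])
  show "P (frag_of x)" for x
    using assms(2)[of "letters (fst x)" "snd x"] by simp
qed (use assms in auto)

lemma tee_commute: "tee m * a = a * (tee m :: ('a, 'n::comm_monoid_add) npoly)"
  by (induction a rule: npoly_induct) (auto simp: tee_def algebra_simps)

lemma tee_add: "tee (l + m) = tee l * (tee m :: ('a, 'n::comm_monoid_add) npoly)"
  by (simp add: tee_def)

lemma tee_mult_tee: "tee m * p * (tee l * r) = tee (m + l) * (p * (r :: ('a, 'n::comm_monoid_add) npoly))"
proof -
  have "tee m * p * (tee l * r) = tee m * (p * tee l) * r" by (simp only: mult.assoc)
  also have "\<dots> = tee m * (tee l * p) * r" by (simp only: tee_commute[of l p])
  finally show ?thesis by (simp only: tee_add mult.assoc)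
qed

lemma tee_zero: "tee 0 = (1 :: ('a, 'n::comm_monoid_add) npoly)"
  by (simp add: tee_def mono_one)

section \<open>Bracket trees and Lie polynomials\<close>

datatype 'a lie_tree = Leaf 'a | Node "'a lie_tree" "'a lie_tree"

primrec tree_poly :: "'a lie_tree \<Rightarrow> ('a, 'n::monoid_add) npoly" where
  "tree_poly (Leaf x) = mon [x] 0"
| "tree_poly (Node P Q) = tree_poly P * tree_poly Q - tree_poly Q * tree_poly P"

primrec weight :: "'a lie_tree \<Rightarrow> nat" where
  "weight (Leaf x) = 1"
| "weight (Node P Q) = weight P + weight Q"

lemma weight_map [simp]: "weight (map_lie_tree f T) = weight T"
  by (induction T) auto

text \<open>The empty word is excluded because a left-normed commutator needs a first entry.\<close>

definition word_span :: "'a set \<Rightarrow> ('a, 'n) npoly set" where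
  "word_span S = {a. Poly_Mapping.keys a \<subseteq> {(w, m). letters w \<noteq> [] \<and> set (letters w) \<subseteq> S}}"

lemma word_span_induct [consumes 1, case_names zero mono diff]:
  fixes a :: "('a, 'n) npoly"
  assumes "a \<in> word_span S"
    and "P 0" "\<And>w m. w \<noteq> [] \<Longrightarrow> set w \<subseteq> S \<Longrightarrow> P (mon w m)" "\<And>a b. P a \<Longrightarrow> P b \<Longrightarrow> P (a - b)"
  shows "P a"
proof (rule frag_induction)
  show "Poly_Mapping.keys a \<subseteq> {(w, m). letters w \<noteq> [] \<and> set (letters w) \<subseteq> S}"
    using assms(1) by (simp add: word_span_def)
  show "P (frag_of x)" if "x \<in> {(w, m). letters w \<noteq> [] \<and> set (letters w) \<subseteq> S}" for x
    using assms(3)[of "letters (fst x)" "snd x"] that by auto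
qed (use assms in auto)

lemma word_span_zero: "0 \<in> word_span S"
  by (simp add: word_span_def)

lemma word_span_diff: "a \<in> word_span S \<Longrightarrow> b \<in> word_span S \<Longrightarrow> a - b \<in> word_span S"
  using keys_diff[of a b] by (auto simp: word_span_def)

lemma word_span_mono: "w \<noteq> [] \<Longrightarrow> set w \<subseteq> S \<Longrightarrow> mon w m \<in> word_span S"
  by (simp add: word_span_def)

lemma word_span_mult:
  fixes a b :: "('a, 'n::comm_monoid_add) npoly"
  assumes "a \<in> word_span S" "b \<in> word_span S"
  shows "a * b \<in> word_span S"
  using assms(1)
proof (induction a rule: word_span_induct)
  case (mono w m)
  from assms(2) show ?case
    using mono by (induction b rule: word_span_induct)
      (auto simp: algebra_simps word_span_zero word_span_mono word_span_diff)
qed (auto simp: algebra_simps word_span_zero word_span_diff)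

lemma word_span_tee: "a \<in> word_span S \<Longrightarrow> tee m * a \<in> (word_span S :: ('a, 'n::comm_monoid_add) npoly set)"
  by (induction a rule: word_span_induct)
    (auto simp: algebra_simps word_span_zero word_span_mono word_span_diff)

text \<open>The Lie ring generated by the letters over the group ring. Spanning it by bracket trees
  lets the same tree be read both as a polynomial and as a group commutator.\<close>

inductive_set lie_span :: "'a set \<Rightarrow> ('a, 'n::comm_monoid_add) npoly set" for S where
  zero: "0 \<in> lie_span S"
| tree: "set_lie_tree T \<subseteq> S \<Longrightarrow> tee m * tree_poly T \<in> lie_span S"
| diff: "a \<in> lie_span S \<Longrightarrow> b \<in> lie_span S \<Longrightarrow> a - b \<in> lie_span S"

lemma lie_span_uminus: "a \<in> lie_span S \<Longrightarrow> - a \<in> lie_span S"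
  using lie_span.diff[OF lie_span.zero, of a S] by simp

lemma lie_span_add: "a \<in> lie_span S \<Longrightarrow> b \<in> lie_span S \<Longrightarrow> a + b \<in> lie_span S"
  using lie_span.diff[of a S "- b"] lie_span_uminus[of b S] by simp

lemma lie_span_sum: "(\<And>i. i \<in> I \<Longrightarrow> f i \<in> lie_span S) \<Longrightarrow> sum f I \<in> lie_span S"
  by (induction I rule: infinite_finite_induct) (auto intro: lie_span_add lie_span.zero)

lemma lie_span_word_span:
  "a \<in> (lie_span S :: ('a, 'n::comm_monoid_add) npoly set) \<Longrightarrow> a \<in> word_span S"
proof (induction rule: lie_span.induct)
  case (tree T m)
  then have "tree_poly T \<in> (word_span S :: ('a, 'n) npoly set)"
    by (induction T) (auto intro!: word_span_diff word_span_mult word_span_mono)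
  then show ?case by (rule word_span_tee)
qed (auto intro: word_span_zero word_span_diff)

lemma lie_span_commutator:
  fixes a b :: "('a, 'n::comm_monoid_add) npoly"
  assumes "a \<in> lie_span S" "b \<in> lie_span S"
  shows "a * b - b * a \<in> lie_span S"
  using assms(1)
proof (induction rule: lie_span.induct)
  case (diff a a')
  have "(a - a') * b - b * (a - a') = (a * b - b * a) - (a' * b - b * a')" by (simp add: algebra_simps)
  then show ?case using lie_span.diff[OF diff.IH] by simp
next
  case (tree T m)
  define p :: "('a, 'n) npoly" where "p = tree_poly T"
  from assms(2) show ?case unfolding p_def[symmetric]
  proof (induction rule: lie_span.induct)
    case (diff a a')
    have "tee m * p * (a - a') - (a - a') * (tee m * p)
      = (tee m * p * a - a * (tee m * p)) - (tee m * p * a' - a' * (tee m * p))"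
      by (simp add: algebra_simps)
    then show ?case using lie_span.diff[OF diff.IH] by simp
  next
    case (tree T' l)
    define r :: "('a, 'n) npoly" where "r = tree_poly T'"
    have "tee l * r * (tee m * p) = tee (m + l) * (r * p)"
      by (simp add: tee_mult_tee add.commute)
    then have "tee m * p * (tee l * r) - tee l * r * (tee m * p) = tee (m + l) * tree_poly (Node T T')"
      by (simp add: tee_mult_tee p_def r_def right_diff_distrib)
    then show ?case using lie_span.tree[of "Node T T'" S "m + l"] tree \<open>set_lie_tree T \<subseteq> S\<close>
      by (simp add: r_def)
  qed (simp_all add: lie_span.zero)
qed (simp_all add: lie_span.zero)

definition map_npoly :: "('a \<Rightarrow> 'b) \<Rightarrow> ('a, 'n) npoly \<Rightarrow> ('b, 'n) npoly" where
  "map_npoly f = frag_extend (\<lambda>(w, m). mon (map f (letters w)) m)"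

lemma map_npoly_mono [simp]: "map_npoly f (mon w m) = mon (map f w) m"
  by (simp add: map_npoly_def)

lemma map_npoly_zero [simp]: "map_npoly f 0 = 0"
  by (simp add: map_npoly_def)

lemma map_npoly_diff [simp]: "map_npoly f (a - b) = map_npoly f a - map_npoly f b"
  by (simp add: map_npoly_def frag_extend_diff)

lemma map_npoly_add [simp]: "map_npoly f (a + b) = map_npoly f a + map_npoly f b"
  by (simp add: map_npoly_def frag_extend_add)

lemma map_npoly_sum [simp]: "map_npoly f (sum g I) = (\<Sum>i\<in>I. map_npoly f (g i))"
  by (induction I rule: infinite_finite_induct) auto

lemma map_npoly_mult [simp]:
  "map_npoly f (a * b) = map_npoly f a * (map_npoly f b :: ('b, 'n::comm_monoid_add) npoly)"
proof (induction a rule: npoly_induct)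
  case (mono w m)
  show ?case by (induction b rule: npoly_induct) (auto simp: algebra_simps)
qed (auto simp: algebra_simps)

lemma map_npoly_tee [simp]: "map_npoly f (tee m) = tee m"
  by (simp add: tee_def)

lemma map_npoly_tree [simp]:
  "map_npoly f (tree_poly T :: ('a, 'n::comm_monoid_add) npoly) = tree_poly (map_lie_tree f T)"
  by (induction T) auto

section \<open>Evaluating polynomials at left-normed commutators\<close>

text \<open>\<open>c\<close> is the class of \<open>G\<close>, and \<open>act\<close> is an action of the additive group \<open>'n\<close> whose norm is trivial.\<close>
locale graded_lie = central_filtration G N for G (structure) and N +
  fixes c :: nat and act :: "'n::{finite, comm_ring_1} \<Rightarrow> 'a \<Rightarrow> 'a" and idx :: "'n list"
  assumes c_pos: "c \<ge> 1" and N_top: "N (Suc c) = {\<one>}"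
    and act_hom: "act i \<in> hom G G"
    and act_zero: "x \<in> carrier G \<Longrightarrow> act 0 x = x"
    and act_add: "x \<in> carrier G \<Longrightarrow> act (i + j) x = act i (act j x)"
    and norm: "x \<in> carrier G \<Longrightarrow> foldr (\<lambda>i r. act i x \<otimes> r) idx \<one> = \<one>"
    and idx: "distinct idx" "set idx = UNIV"
    and torsion: "x \<in> carrier G \<Longrightarrow> x [^] CARD('n) = \<one> \<Longrightarrow> x = \<one>"
    and unit: "(i :: 'n) \<noteq> 0 \<Longrightarrow> \<exists>k. i * k = 1"
begin

lemma N_beyond: "x \<in> N i \<Longrightarrow> c < i \<Longrightarrow> x = \<one>"
  using N_mono[of "Suc c" i] N_top by auto

lemma N_comm': "x \<in> N i \<Longrightarrow> y \<in> carrier G \<Longrightarrow> comm x y \<in> N (Suc i)"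
  using N_comm[of x i y 1] N_1 by simp

lemma N_c_commute: "x \<in> N c \<Longrightarrow> y \<in> carrier G \<Longrightarrow> x \<otimes> y = y \<otimes> x"
  using N_beyond[OF N_comm'[of x c y]] comm_eq_one N_carrier by auto

lemma foldl_comm_closed: "x \<in> N i \<Longrightarrow> set ys \<subseteq> carrier G \<Longrightarrow> foldl comm x ys \<in> N (i + length ys)"
proof (induction ys arbitrary: x i)
  case (Cons y ys)
  then show ?case using Cons.IH[of "comm x y" "Suc i"] N_comm' by auto
qed auto

text \<open>In \<open>comm (x \<otimes> y) z = comm x z \<otimes> comm (comm x z) y \<otimes> comm y
  z\<close> the middle factor is one term deeper, so it dies when the total weight reaches
  \<open>c\<close>.\<close>

lemma foldl_comm_mult:
  assumes "x \<in> N i" "y \<in> N i" "set ys \<subseteq> carrier G" "i + length ys = c"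
  shows "foldl comm (x \<otimes> y) ys = foldl comm x ys \<otimes> foldl comm y ys"
  using assms
proof (induction ys arbitrary: x y i)
  case (Cons z ys)
  have z: "z \<in> carrier G" "set ys \<subseteq> carrier G" and len: "Suc i + length ys = c"
    using Cons.prems by auto
  have car: "x \<in> carrier G" "y \<in> carrier G" using Cons.prems N_carrier by auto
  define a b d where "a = comm x z" and "b = comm (comm x z) y" and "d = comm y z"
  have a: "a \<in> N (Suc i)" and d: "d \<in> N (Suc i)"
    using Cons.prems z N_comm' by (auto simp: a_def d_def)
  have b: "b \<in> N (Suc (Suc i))" using N_comm'[OF a car(2)] by (simp add: a_def b_def)
  have b': "b \<in> N (Suc i)" using b N_Suc by blast
  have "foldl comm b ys = \<one>"
    using N_beyond[OF foldl_comm_closed[OF b z(2)]] len by simp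
  moreover have "foldl comm (a \<otimes> b) ys = foldl comm a ys \<otimes> foldl comm b ys"
    using Cons.IH[OF a b' z(2) len] .
  moreover have "foldl comm (a \<otimes> b \<otimes> d) ys = foldl comm (a \<otimes> b) ys \<otimes> foldl comm d ys"
    using Cons.IH[OF N_closed(2)[OF a b'] d z(2) len] .
  ultimately show ?case
    using N_carrier[OF foldl_comm_closed[OF a z(2)]] comm_mult_left[OF car z(1)]
    by (simp add: a_def b_def d_def)
qed auto

lemma foldl_comm_one: "set ys \<subseteq> carrier G \<Longrightarrow> foldl comm \<one> ys = \<one>"
  by (induction ys) auto

section \<open>Additive maps into the last term of the filtration\<close>

definition additive :: "(('a, 'n) npoly \<Rightarrow> 'a) \<Rightarrow> bool" where
  "additive F \<longleftrightarrow> F 0 = \<one> \<and> (\<forall>a. F a \<in> N c) \<and> (\<forall>a b. F (a - b) = F a \<otimes> inv (F b))"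

lemma additiveD:
  assumes "additive F"
  shows "F 0 = \<one>" "F a \<in> N c" "F (a - b) = F a \<otimes> inv (F b)" "F a \<in> carrier G"
  using assms N_carrier by (auto simp: additive_def)

lemma additive_add: "additive F \<Longrightarrow> F (a + b) = F a \<otimes> F b"
  using additiveD(3)[of F 0 b] additiveD(3)[of F a "0 - b"] by (simp add: additiveD)

lemma additive_of_nat: "additive F \<Longrightarrow> F (of_nat n * a) = F a [^] n"
proof (induction n)
  case (Suc n)
  have "F (of_nat (Suc n) * a) = F (of_nat n * a + a)" by (simp add: algebra_simps)
  then show ?case using Suc by (simp add: additive_add)
qed (simp add: additiveD)

lemma additive_ext:
  "additive F \<Longrightarrow> additive H \<Longrightarrow> (\<And>w m. F (mon w m) = H (mon w m)) \<Longrightarrow> F a = H a"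
  by (induction a rule: npoly_induct) (auto simp: additiveD)

lemma additive_mult_left: "additive F \<Longrightarrow> additive (\<lambda>b. F (a * b))"
  by (simp add: additive_def right_diff_distrib)

lemma additive_mult_right: "additive F \<Longrightarrow> additive (\<lambda>a. F (a * b))"
  by (simp add: additive_def left_diff_distrib)

lemma additive_map: "additive F \<Longrightarrow> additive (\<lambda>a. F (map_npoly f a))"
  by (simp add: additive_def)

lemma additive_one: "additive (\<lambda>a. \<one>)"
  by (simp add: additive_def N_closed)

lemma additive_mult:
  assumes "additive F" "additive H"
  shows "additive (\<lambda>a. F a \<otimes> H a)"
proof -
  have "F (a - b) \<otimes> H (a - b) = F a \<otimes> H a \<otimes> inv (F b \<otimes> H b)" for a b
  proof -
    have "inv (F b) \<otimes> (H a \<otimes> inv (H b)) = (H a \<otimes> inv (H b)) \<otimes> inv (F b)"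
      by (rule N_c_commute) (use assms in \<open>auto simp: additiveD intro: N_closed\<close>)
    then show ?thesis
      using assms by (simp add: additiveD inv_mult_group m_assoc)
  qed
  then show ?thesis using assms by (auto simp: additive_def N_closed)
qed

definition lin :: "('a list \<Rightarrow> 'n \<Rightarrow> 'a) \<Rightarrow> ('a, 'n) npoly \<Rightarrow> 'a" where
  "lin f = (SOME h. additive h \<and> (\<forall>w m. h (mon w m) = f w m))"

text \<open>The term \<open>N c\<close> is central, hence abelian, and polynomials form the free
  abelian group on the monomials, whose universal property provides the map.\<close>

lemma lin:
  assumes "\<And>w m. f w m \<in> N c"
  shows "additive (lin f)" "lin f (mon w m) = f w m"
proof -
  interpret W: comm_group "G\<lparr>carrier := N c\<rparr>"
    by (intro group.group_comm_groupI subgroup_imp_group N_subgroup)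
      (auto intro: N_c_commute N_carrier)
  obtain h where h: "h \<in> hom (free_Abelian_group UNIV) (G\<lparr>carrier := N c\<rparr>)"
      "\<And>x. h (frag_of x) = f (letters (fst x)) (snd x)"
    using W.free_Abelian_group_universal[of "\<lambda>x. f (letters (fst x)) (snd x)" UNIV] assms by auto
  have N: "h a \<in> N c" for a
    using hom_in_carrier[OF h(1), of a] by simp
  have add: "h (a + b) = h a \<otimes> h b" for a b
    using hom_mult[OF h(1), of a b] by simp
  have "h 0 = \<one>" using add[of 0 0] N_carrier[OF N] by (simp add: l_cancel_one')
  moreover have "h (a - b) = h a \<otimes> inv (h b)" for a b
    using add[of "a - b" b] N_carrier[OF N] by (simp add: m_assoc)
  ultimately have "additive h \<and> (\<forall>w m. h (mon w m) = f w m)"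
    using N h(2) by (simp add: additive_def)
  then have "additive (lin f) \<and> (\<forall>w m. lin f (mon w m) = f w m)"
    unfolding lin_def by (rule someI[of "\<lambda>h. additive h \<and> (\<forall>w m. h (mon w m) = f w m)"])
  then show "additive (lin f)" "lin f (mon w m) = f w m" by auto
qed

text \<open>\<open>ev j g m\<close> multiplies the left-normed commutators \<open>[g, x\<^sub>1, \<dots>, x\<^sub>k]\<close> of weight \<open>j + k = c\<close>
  over the monomials \<open>x\<^sub>1 \<dots> x\<^sub>k t\<^sup>m\<close>; \<open>evt\<close> does so without the initial \<open>g\<close>.\<close>
definition ev :: "nat \<Rightarrow> 'a \<Rightarrow> 'n \<Rightarrow> ('a, 'n) npoly \<Rightarrow> 'a" where
  "ev j g m = lin (\<lambda>w m'. if m' = m \<and> set w \<subseteq> carrier G \<and> j + length w = c then foldl comm g w else \<one>)"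

lemma ev:
  assumes "g \<in> N j"
  shows "additive (ev j g m)"
    "ev j g m (mon w m') = (if m' = m \<and> set w \<subseteq> carrier G \<and> j + length w = c then foldl comm g w else \<one>)"
proof -
  have "(if m' = m \<and> set w \<subseteq> carrier G \<and> j + length w = c then foldl comm g w else \<one>) \<in> N c" for w m'
    using foldl_comm_closed[OF assms, of w] by (auto simp: N_closed)
  note lin[of "\<lambda>w m'. if m' = m \<and> set w \<subseteq> carrier G \<and> j + length w = c then foldl comm g w else \<one>", OF this]
  then show "additive (ev j g m)"
    "ev j g m (mon w m') = (if m' = m \<and> set w \<subseteq> carrier G \<and> j + length w = c then foldl comm g w else \<one>)"
    unfolding ev_def by auto
qed

lemma ev_mult:
  assumes "g \<in> N j" "h \<in> N j"
  shows "ev j (g \<otimes> h) m b = ev j g m b \<otimes> ev j h m b"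
  by (rule additive_ext[of _ "\<lambda>b. ev j g m b \<otimes> ev j h m b"])
    (use assms foldl_comm_mult in \<open>auto simp: ev N_closed intro!: additive_mult\<close>)

lemma ev_beyond:
  assumes "g \<in> N (Suc j)"
  shows "ev j g m b = \<one>"
proof (rule additive_ext[of _ "\<lambda>b. \<one>"])
  have g: "g \<in> N j" using assms N_Suc by auto
  show "additive (ev j g m)" by (rule ev(1)[OF g])
  show "ev j g m (mon w m') = \<one>" for w m'
    using N_beyond[OF foldl_comm_closed[OF assms, of w]] by (simp add: ev(2)[OF g])
qed (rule additive_one)

lemma ev_one: "ev j \<one> m b = \<one>"
  by (rule ev_beyond) (rule N_closed)

lemma ev_tee:
  assumes "g \<in> N j"
  shows "ev j g m (tee l * b) = ev j g (m - l) b"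
  by (rule additive_ext[of "\<lambda>b. ev j g m (tee l * b)"])
    (use assms in \<open>auto simp: ev algebra_simps intro!: additive_mult_left\<close>)

text \<open>Expand \<open>comm g (p \<otimes> q)\<close> directly and through
  \<open>p \<otimes> q = q \<otimes> p \<otimes> comm p q\<close>; the discrepancies are deeper
  commutators. The weight of \<open>g\<close> must be positive, because \<open>comm B A\<close> has
  weight \<open>2 * Suc j + a + b\<close>.\<close>

lemma jacobi:
  assumes "g \<in> N (Suc j)" "p \<in> N a" "q \<in> N b"
  obtains z where "z \<in> N (Suc (Suc j + a + b))"
    "comm (comm g p) q = comm g (comm p q) \<otimes> comm (comm g q) p \<otimes> z"
proof
  have car: "g \<in> carrier G" "p \<in> carrier G" "q \<in> carrier G" using assms N_carrier by auto
  define A B C D e E where "A = comm g q" and "B = comm g p" and "C = comm g (comm p q)"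
    and "D = comm (comm g q) p" and "e = comm (comm g (q \<otimes> p)) (comm p q)" and "E = comm (comm g p) q"
  have car': "A \<in> carrier G" "B \<in> carrier G" "C \<in> carrier G" "D \<in> carrier G" "e \<in> carrier G" "E \<in> carrier G"
    using car by (simp_all add: A_def B_def C_def D_def e_def E_def)
  have "A \<otimes> B \<otimes> E = comm g (p \<otimes> q)"
    using car by (simp add: comm_mult_right A_def B_def E_def)
  also have "p \<otimes> q = q \<otimes> p \<otimes> comm p q" using car by (simp add: comm_def word_simps)
  also have "comm g \<dots> = C \<otimes> comm g (q \<otimes> p) \<otimes> e"
    using car by (simp only: comm_mult_right C_def e_def comm_closed m_closed)
  also have "comm g (q \<otimes> p) = B \<otimes> A \<otimes> D"
    using car by (simp add: comm_mult_right A_def B_def D_def)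
  finally have "A \<otimes> B \<otimes> E = C \<otimes> (B \<otimes> A \<otimes> D) \<otimes> e" .
  then have "E = inv (A \<otimes> B) \<otimes> (C \<otimes> (B \<otimes> A \<otimes> D) \<otimes> e)"
    using car' by (metis inv_solve_left m_closed)
  also have "\<dots> = C \<otimes> D \<otimes> (inv D \<otimes> (comm C (A \<otimes> B) \<otimes> comm B A) \<otimes> D \<otimes> e)"
    using car' by (simp add: comm_def[of C] comm_def[of B] word_simps)
  finally show "comm (comm g p) q = comm g (comm p q) \<otimes> comm (comm g q) p
    \<otimes> (inv D \<otimes> (comm C (A \<otimes> B) \<otimes> comm B A) \<otimes> D \<otimes> e)"
    by (simp add: E_def C_def D_def)
  have "C \<in> N (Suc j + (a + b))"
    using N_comm[OF assms(1) N_comm[OF assms(2,3)]] by (simp add: C_def)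
  then have "comm C (A \<otimes> B) \<in> N (Suc (Suc j + a + b))"
    using N_comm' car' by (simp add: add.assoc)
  moreover have "comm B A \<in> N (Suc (Suc j + a + b))"
    using N_comm[OF N_comm[OF assms(1,2)] N_comm[OF assms(1,3)]]
    by (auto simp: A_def B_def elim: N_monoD)
  moreover have "comm (comm g (q \<otimes> p)) (comm p q) \<in> N (Suc (Suc j) + (a + b))"
    using N_comm[OF N_comm'[OF assms(1), of "q \<otimes> p"] N_comm[OF assms(2,3)]] car by simp
  then have "e \<in> N (Suc (Suc j + a + b))"
    by (simp add: e_def add.assoc)
  ultimately show "inv D \<otimes> (comm C (A \<otimes> B) \<otimes> comm B A) \<otimes> D \<otimes> e \<in> N (Suc (Suc j + a + b))"
    by (intro N_closed N_conj car') auto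
qed

primrec tree_comm :: "'a lie_tree \<Rightarrow> 'a" where
  "tree_comm (Leaf x) = x"
| "tree_comm (Node P Q) = comm (tree_comm P) (tree_comm Q)"

lemma tree_comm_closed: "set_lie_tree T \<subseteq> carrier G \<Longrightarrow> tree_comm T \<in> N (weight T)"
  by (induction T) (auto simp: N_1[simplified] N_comm)

text \<open>The bridge between the ring and the group: multiplying by a Lie polynomial amounts to
  taking the commutator with the group element of the same tree. At a \<open>Node\<close> this is
  \<open>jacobi\<close>, whose error term is sent to one by \<open>ev_beyond\<close>.\<close>

lemma ev_tree:
  assumes "g \<in> N (Suc j)" "set_lie_tree T \<subseteq> carrier G"
  shows "ev (Suc j) g m (tree_poly T * b) = ev (Suc j + weight T) (comm g (tree_comm T)) m b"
  using assms
proof (induction T arbitrary: g j b)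
  case (Leaf x)
  then have x: "x \<in> carrier G" and gx: "comm g x \<in> N (Suc j + 1)" using N_comm' by auto
  show ?case
    unfolding tree_poly.simps weight.simps tree_comm.simps
  proof (rule additive_ext)
    show "additive (\<lambda>b. ev (Suc j) g m (mon [x] 0 * b))"
      by (rule additive_mult_left[OF ev(1)[OF Leaf(1)]])
    show "additive (ev (Suc j + 1) (comm g x) m)" by (rule ev(1)[OF gx])
    show "ev (Suc j) g m (mon [x] 0 * mon w m') = ev (Suc j + 1) (comm g x) m (mon w m')" for w m'
      unfolding mono_mult ev(2)[OF Leaf(1)] ev(2)[OF gx] using x by simp
  qed
next
  case (Node P Q)
  define p q where "p = tree_comm P" and "q = tree_comm Q"
  have p: "p \<in> N (weight P)" and q: "q \<in> N (weight Q)"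
    using Node.prems tree_comm_closed by (auto simp: p_def q_def)
  let ?J = "Suc j + weight P + weight Q"
  have gp: "comm g p \<in> N (Suc (j + weight P))" and gq: "comm g q \<in> N (Suc (j + weight Q))"
    using N_comm[OF Node.prems(1) p] N_comm[OF Node.prems(1) q] by auto
  have PQ: "ev (Suc j) g m (tree_poly P * (tree_poly Q * b)) = ev ?J (comm (comm g p) q) m b"
    using Node.IH(1)[OF Node.prems(1)] Node.IH(2)[OF gp] Node.prems(2) by (simp add: p_def q_def)
  have "ev (Suc j) g m (tree_poly Q * (tree_poly P * b)) = ev (Suc j + weight Q + weight P) (comm (comm g q) p) m b"
    using Node.IH(2)[OF Node.prems(1)] Node.IH(1)[OF gq] Node.prems(2) by (simp add: p_def q_def)
  then have QP: "ev (Suc j) g m (tree_poly Q * (tree_poly P * b)) = ev ?J (comm (comm g q) p) m b"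
    by (simp add: ac_simps)
  obtain z where z: "z \<in> N (Suc ?J)"
    and eq: "comm (comm g p) q = comm g (comm p q) \<otimes> comm (comm g q) p \<otimes> z"
    using jacobi[OF Node.prems(1) p q] .
  have 1: "comm g (comm p q) \<in> N ?J"
    using N_comm[OF Node.prems(1) N_comm[OF p q]] by (simp add: add.assoc)
  have 2: "comm (comm g q) p \<in> N ?J"
    using N_comm[OF gq p] by (simp add: ac_simps)
  have "ev ?J (comm (comm g p) q) m b = ev ?J (comm g (comm p q)) m b \<otimes> ev ?J (comm (comm g q) p) m b"
    unfolding eq using z N_Suc 1 2 ev(1)[OF 1] ev(1)[OF 2]
    by (simp add: ev_mult N_closed ev_beyond additiveD subset_iff)
  moreover have "ev (Suc j) g m (tree_poly (Node P Q) * b)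
    = ev (Suc j) g m (tree_poly P * (tree_poly Q * b) - tree_poly Q * (tree_poly P * b))"
    by (simp add: algebra_simps)
  ultimately show ?case
    using additiveD[OF ev(1)[OF Node.prems(1)]] additiveD[OF ev(1)[OF 1]] additiveD[OF ev(1)[OF 2]] PQ QP
    by (simp add: p_def q_def m_assoc add.assoc)
qed

end

context graded_lie
begin

definition lnc :: "'a list \<Rightarrow> 'a" where
  "lnc w = foldl comm (hd w) (tl w)"

lemma lnc_closed: "w \<noteq> [] \<Longrightarrow> set w \<subseteq> carrier G \<Longrightarrow> lnc w \<in> N (length w)"
  using foldl_comm_closed[of "hd w" 1 "tl w"] by (cases w) (auto simp: lnc_def N_1[simplified])

definition evt :: "'n \<Rightarrow> ('a, 'n) npoly \<Rightarrow> 'a" where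
  "evt m = lin (\<lambda>w m'. if m' = m \<and> set w \<subseteq> carrier G \<and> length w = c then lnc w else \<one>)"

lemma evt:
  "additive (evt m)"
  "evt m (mon w m') = (if m' = m \<and> set w \<subseteq> carrier G \<and> length w = c then lnc w else \<one>)"
proof -
  have "(if m' = m \<and> set w \<subseteq> carrier G \<and> length w = c then lnc w else \<one>) \<in> N c" for w m'
    using lnc_closed[of w] c_pos by (cases "w = []") (auto simp: N_closed)
  note lin[of "\<lambda>w m'. if m' = m \<and> set w \<subseteq> carrier G \<and> length w = c then lnc w else \<one>", OF this]
  then show "additive (evt m)"
    "evt m (mon w m') = (if m' = m \<and> set w \<subseteq> carrier G \<and> length w = c then lnc w else \<one>)"
    unfolding evt_def by auto
qed

lemma evt_mono_mult:
  assumes "w \<noteq> []" "set w \<subseteq> carrier G"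
  shows "evt m (mon w m' * b) = ev (length w) (lnc w) (m - m') b"
proof (rule additive_ext)
  note w = lnc_closed[OF assms]
  show "additive (\<lambda>b. evt m (mon w m' * b))" by (rule additive_mult_left[OF evt(1)])
  show "additive (ev (length w) (lnc w) (m - m'))" by (rule ev(1)[OF w])
  show "evt m (mon w m' * mon v k) = ev (length w) (lnc w) (m - m') (mon v k)" for v k
  proof -
    have "lnc (w @ v) = foldl comm (lnc w) v" using assms(1) by (cases w) (auto simp: lnc_def)
    then show ?thesis unfolding mono_mult evt(2) ev(2)[OF w] using assms(2) by (auto simp: algebra_simps)
  qed
qed

lemma evt_tee: "evt m (tee l * b) = evt (m - l) b"
  by (rule additive_ext[of "\<lambda>b. evt m (tee l * b)"])
    (auto simp: evt algebra_simps intro!: additive_mult_left)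

section \<open>The action and its trivial norm\<close>

lemma act_closed: "x \<in> carrier G \<Longrightarrow> act i x \<in> carrier G"
  using act_hom[of i] hom_in_carrier by metis

lemma act_image: "S \<subseteq> carrier G \<Longrightarrow> act i ` S \<subseteq> carrier G"
  using act_closed by auto

lemma act_comm: "x \<in> carrier G \<Longrightarrow> y \<in> carrier G \<Longrightarrow> act i (comm x y) = comm (act i x) (act i y)"
proof -
  interpret h: group_hom G G "act i" using act_hom by unfold_locales
  show "x \<in> carrier G \<Longrightarrow> y \<in> carrier G \<Longrightarrow> act i (comm x y) = comm (act i x) (act i y)"
    by (simp add: comm_def)
qed

lemma act_foldl: "x \<in> carrier G \<Longrightarrow> set ys \<subseteq> carrier G \<Longrightarrow>
    act i (foldl comm x ys) = foldl comm (act i x) (map (act i) ys)"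
  by (induction ys arbitrary: x) (auto simp: act_comm)

lemma act_lnc: "w \<noteq> [] \<Longrightarrow> set w \<subseteq> carrier G \<Longrightarrow> lnc (map (act i) w) = act i (lnc w)"
  by (cases w) (auto simp: lnc_def act_foldl)

lemma act_tree_comm:
  "set_lie_tree T \<subseteq> carrier G \<Longrightarrow> tree_comm (map_lie_tree (act i) T) = act i (tree_comm T)"
  using N_carrier[OF tree_comm_closed] by (induction T) (simp_all add: act_comm)

text \<open>The product is ordered like the one in \<open>norm\<close>, since the conjugates of a
  group element under the action need not commute.\<close>

definition nprod :: "('n \<Rightarrow> 'a) \<Rightarrow> 'a" where
  "nprod f = foldr (\<lambda>i r. f i \<otimes> r) idx \<one>"

lemma additive_nprod: "(\<And>i. additive (F i)) \<Longrightarrow> additive (\<lambda>u. nprod (\<lambda>i. F i u))"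
proof -
  assume "\<And>i. additive (F i)"
  then have "additive (\<lambda>u. foldr (\<lambda>i r. F i u \<otimes> r) xs \<one>)" for xs
    by (induction xs) (auto intro: additive_mult additive_one)
  then show ?thesis unfolding nprod_def .
qed

text \<open>A map that is multiplicative on \<open>N j\<close> can be pulled out of the product,
  which leaves its value at the norm of \<open>x\<close>.\<close>

lemma nprod_act:
  assumes "x \<in> carrier G" "\<And>i. act i x \<in> N j"
    and "\<And>y z. y \<in> N j \<Longrightarrow> z \<in> N j \<Longrightarrow> f (y \<otimes> z) = f y \<otimes> f z" "f \<one> = \<one>"
  shows "nprod (\<lambda>i. f (act i x)) = \<one>"
proof -
  have "foldr (\<lambda>i r. f (act i x) \<otimes> r) xs \<one> = f (foldr (\<lambda>i r. act i x \<otimes> r) xs \<one>)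
      \<and> foldr (\<lambda>i r. act i x \<otimes> r) xs \<one> \<in> N j" for xs
    using assms by (induction xs) (auto simp: N_closed)
  then show ?thesis unfolding nprod_def using norm[OF assms(1)] assms(4) by simp
qed

lemma nprod_const: "x \<in> carrier G \<Longrightarrow> nprod (\<lambda>i. x) = x [^] CARD('n)"
proof -
  assume x: "x \<in> carrier G"
  have "foldr (\<lambda>i r. x \<otimes> r) xs \<one> = x [^] length xs" for xs :: "'n list"
    using x by (induction xs) (auto simp: nat_pow_Suc2[symmetric] simp del: nat_pow_Suc)
  moreover have "length idx = CARD('n)"
    using idx distinct_card by metis
  ultimately show ?thesis by (simp add: nprod_def)
qed

text \<open>On a monomial the norm is taken of the left-normed commutator of its letters, and
  \<open>ev\<close> is multiplicative in that element.\<close>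

lemma nprod_evt_word:
  assumes "u \<in> word_span (carrier G)"
  shows "nprod (\<lambda>i. evt m (map_npoly (act i) u * b)) = \<one>"
  using assms
proof (induction u rule: word_span_induct)
  case (mono w k)
  have "evt m (map_npoly (act i) (mon w k) * b) = ev (length w) (act i (lnc w)) (m - k) b" for i
    using mono evt_mono_mult[of "map (act i) w"] by (simp add: act_lnc act_image)
  moreover have "nprod (\<lambda>i. ev (length w) (act i (lnc w)) (m - k) b) = \<one>"
  proof (rule nprod_act)
    show "act i (lnc w) \<in> N (length w)" for i
      using lnc_closed[of "map (act i) w"] mono act_closed act_lnc[of w i] by auto
    show "lnc w \<in> carrier G" using lnc_closed[OF mono] N_carrier by auto
  qed (auto simp: ev_mult ev_one)
  ultimately show ?case by simp
next
  case zero
  have "additive (\<lambda>u. nprod (\<lambda>i. evt m (map_npoly (act i) u * b)))"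
    by (intro additive_nprod additive_map[of "\<lambda>a. evt m (a * b)"] additive_mult_right evt)
  from additiveD(1)[OF this] show ?case .
next
  case (diff u v)
  have "additive (\<lambda>u. nprod (\<lambda>i. evt m (map_npoly (act i) u * b)))"
    by (intro additive_nprod additive_map[of "\<lambda>a. evt m (a * b)"] additive_mult_right evt)
  from additiveD(3)[OF this] diff show ?case by simp
qed

text \<open>Now the norm is taken in the second argument: \<open>ev_tree\<close> turns
  \<open>y\<close> into a commutator with a tree element, and \<open>comm g\<close> is
  multiplicative modulo terms that \<open>ev\<close> sends to one.\<close>

lemma nprod_evt_lie:
  assumes u: "u \<in> word_span (carrier G)" and y: "y \<in> lie_span (carrier G)"
  shows "nprod (\<lambda>i. evt m (u * map_npoly (act i) y * b)) = \<one>"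
  using u
proof (induction u rule: word_span_induct)
  case (mono w k)
  have A: "additive (\<lambda>y. nprod (\<lambda>i. evt m (mon w k * map_npoly (act i) y * b)))"
    by (intro additive_nprod additive_map[of "\<lambda>a. evt m (mon w k * a * b)"])
      (intro additive_mult_left[of "\<lambda>a. evt m (a * b)"] additive_mult_right evt)
  from y show ?case
  proof (induction rule: lie_span.induct)
    case (tree T l)
    define g J where "g = lnc w" and "J = length w + weight T"
    obtain j where j: "length w = Suc j" using mono(1) by (cases w) auto
    have g: "g \<in> N (length w)" unfolding g_def by (rule lnc_closed[OF mono])
    have T: "tree_comm T \<in> N (weight T)" "act i (tree_comm T) \<in> N (weight T)" for i
      using tree_comm_closed[OF tree] tree_comm_closed[of "map_lie_tree (act i) T"] act_tree_comm[OF tree, of i]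
        act_closed tree by (auto simp: lie_tree.set_map)
    have "evt m (mon w k * map_npoly (act i) (tee l * tree_poly T) * b)
        = ev J (comm g (act i (tree_comm T))) (m - k - l) b" for i
    proof -
      have "evt m (mon w k * map_npoly (act i) (tee l * tree_poly T) * b)
        = evt m (mon w k * (tee l * (tree_poly (map_lie_tree (act i) T) * b)))"
        by (simp add: mult.assoc)
      also have "\<dots> = ev (length w) g (m - k - l) (tree_poly (map_lie_tree (act i) T) * b)"
        unfolding evt_mono_mult[OF mono] using g by (simp add: ev_tee g_def)
      also have "\<dots> = ev J (comm g (act i (tree_comm T))) (m - k - l) b"
        using ev_tree[of g j "map_lie_tree (act i) T"] g j tree act_tree_comm[OF tree]
        by (simp add: J_def lie_tree.set_map act_image)
      finally show ?thesis .
    qed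
    moreover have "nprod (\<lambda>i. ev J (comm g (act i (tree_comm T))) (m - k - l) b) = \<one>"
    proof (rule nprod_act)
      show "tree_comm T \<in> carrier G" using T N_carrier by blast
      show "act i (tree_comm T) \<in> N (weight T)" for i by (rule T)
      show "ev J (comm g (y \<otimes> z)) (m - k - l) b = ev J (comm g y) (m - k - l) b \<otimes> ev J (comm g z) (m - k - l) b"
        if yz: "y \<in> N (weight T)" "z \<in> N (weight T)" for y z
      proof -
        have 1: "comm g y \<in> N J" "comm g z \<in> N J" using N_comm[OF g] yz by (auto simp: J_def)
        have 2: "comm (comm g y) z \<in> N (Suc J)" using N_comm'[OF 1(1)] yz N_carrier by auto
        then have 3: "comm (comm g y) z \<in> N J" using N_Suc by auto
        have "comm g (y \<otimes> z) = comm g z \<otimes> comm g y \<otimes> comm (comm g y) z"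
          using g yz N_carrier by (intro comm_mult_right) auto
        then have "ev J (comm g (y \<otimes> z)) (m - k - l) b
            = ev J (comm g z) (m - k - l) b \<otimes> ev J (comm g y) (m - k - l) b"
          using 1 2 3 additiveD(4)[OF ev(1)[OF 1(1)]] additiveD(4)[OF ev(1)[OF 1(2)]]
          by (simp add: ev_mult N_closed ev_beyond)
        also have "\<dots> = ev J (comm g y) (m - k - l) b \<otimes> ev J (comm g z) (m - k - l) b"
          by (intro N_c_commute additiveD(2,4) ev(1) 1)
        finally show ?thesis .
      qed
      show "ev J (comm g \<one>) (m - k - l) b = \<one>"
        using g N_carrier by (simp add: ev_one)
    qed
    ultimately show ?case by simp
  next
    case zero
    then show ?case using additiveD(1)[OF A] by simp
  next
    case (diff y z)
    then show ?case using additiveD(3)[OF A, of y z] by simp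
  qed
next
  case zero
  have "additive (\<lambda>u. nprod (\<lambda>i. evt m (u * map_npoly (act i) y * b)))"
    unfolding mult.assoc by (intro additive_nprod additive_mult_right evt)
  from additiveD(1)[OF this] show ?case .
next
  case (diff u v)
  have "additive (\<lambda>u. nprod (\<lambda>i. evt m (u * map_npoly (act i) y * b)))"
    unfolding mult.assoc by (intro additive_nprod additive_mult_right evt)
  from additiveD(3)[OF this] diff show ?case by simp
qed

text \<open>With \<open>t\<close> a formal \<open>n\<close>-th root of unity, \<open>M s\<close> and \<open>L s\<close> are the eigenspaces on which \<open>i\<close> acts as \<open>t\<^sup>i\<^sup>s\<close>,
  and \<open>Z\<close> is the largest right ideal on which all evaluations vanish.\<close>
definition M :: "'n \<Rightarrow> ('a, 'n) npoly set" where
  "M s = {u \<in> word_span (carrier G). \<forall>i. map_npoly (act i) u = tee (i * s) * u}"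

definition L :: "'n \<Rightarrow> ('a, 'n) npoly set" where
  "L s = {u \<in> lie_span (carrier G). \<forall>i. map_npoly (act i) u = tee (i * s) * u}"

definition Z :: "('a, 'n) npoly set" where
  "Z = {a. \<forall>b m. evt m (a * b) = \<one>}"

text \<open>Elements of degree zero are invariant, so all factors of the norm products coincide. The
  product is then a \<open>CARD('n)\<close>-th power equal to one, and there is no such
  torsion.\<close>

lemma graded_action_eigen: "graded_action M L Z"
proof
  show "u * x \<in> M (s + i)" if "u \<in> M s" "x \<in> L i" for u x s i
    using that lie_span_word_span
    by (auto simp: M_def L_def tee_mult_tee distrib_left intro!: word_span_mult)
  show "x * y - y * x \<in> L (i + j)" if "x \<in> L i" "y \<in> L j" for x y i j
    using that by (auto simp: L_def tee_mult_tee distrib_left right_diff_distrib add.commute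
        intro!: lie_span_commutator)
  show "M 0 \<subseteq> Z"
  proof
    fix u assume u: "u \<in> M 0"
    have "evt m (u * b) = \<one>" for m b
    proof (rule torsion)
      show "evt m (u * b) \<in> carrier G" by (rule additiveD(4)[OF evt(1)])
      then show "evt m (u * b) [^] CARD('n) = \<one>"
        using nprod_evt_word[of u m b] u nprod_const by (simp add: M_def tee_zero)
    qed
    then show "u \<in> Z" by (simp add: Z_def)
  qed
  show "u * y \<in> Z" if u: "u \<in> M s" and y: "y \<in> L 0" for u s y
  proof -
    have "evt m (u * y * b) = \<one>" for m b
    proof (rule torsion)
      show "evt m (u * y * b) \<in> carrier G" by (rule additiveD(4)[OF evt(1)])
      then show "evt m (u * y * b) [^] CARD('n) = \<one>"
        using nprod_evt_lie[of u y m b] u y nprod_const by (simp add: M_def L_def tee_zero)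
    qed
    then show ?thesis by (simp add: Z_def)
  qed
  show "a + b \<in> Z" if "a \<in> Z" "b \<in> Z" for a b
    using that by (simp add: Z_def distrib_right additive_add[OF evt(1)])
  show "a * x \<in> Z" if "a \<in> Z" for a x
    using that by (simp add: Z_def mult.assoc)
qed

section \<open>Lagrange resolvents and Fourier inversion\<close>

definition eigen :: "'n \<Rightarrow> 'a \<Rightarrow> ('a, 'n) npoly" where
  "eigen j x = (\<Sum>i\<in>UNIV. mon [act i x] (- (i * j)))"

lemma eigen_in_L: "x \<in> carrier G \<Longrightarrow> eigen j x \<in> L j"
proof -
  assume x: "x \<in> carrier G"
  have "mon [y] m \<in> lie_span (carrier G)" if "y \<in> carrier G" for y and m :: 'n
    using lie_span.tree[of "Leaf y" "carrier G" m] that by simp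
  then have "eigen j x \<in> lie_span (carrier G)"
    using x act_closed by (auto simp: eigen_def intro!: lie_span_sum)
  moreover have "map_npoly (act l) (eigen j x) = tee (l * j) * eigen j x" for l
  proof -
    have "map_npoly (act l) (eigen j x) = (\<Sum>i\<in>UNIV. mon [act (l + i) x] (l * j - (l + i) * j))"
    proof -
      have "l * j - (l + i) * j = - (i * j)" for i by (simp add: algebra_simps)
      then show ?thesis using x by (simp add: eigen_def act_add)
    qed
    also have "\<dots> = (\<Sum>i\<in>UNIV. mon [act i x] (l * j - i * j))"
      by (rule sum.reindex_bij_witness[of _ "\<lambda>i. i - l" "\<lambda>i. l + i"]) auto
    finally show ?thesis by (simp add: eigen_def sum_distrib_left)
  qed
  ultimately show ?thesis by (simp add: L_def)
qed

lemma eigen_in_M: "x \<in> carrier G \<Longrightarrow> eigen j x \<in> M j"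
  using eigen_in_L[of x j] by (auto simp: L_def M_def intro: lie_span_word_span)

definition \<tau> :: "('a, 'n) npoly" where
  "\<tau> = (\<Sum>m\<in>UNIV. tee m)"

lemma tau_commute: "a * \<tau> = \<tau> * a"
  by (simp add: \<tau>_def sum_distrib_left sum_distrib_right tee_commute)

lemma tee_tau: "tee l * \<tau> = \<tau>"
  unfolding \<tau>_def sum_distrib_left tee_add[symmetric]
  by (rule sum.reindex_bij_witness[of _ "\<lambda>i. i - l" "\<lambda>i. l + i"]) auto

text \<open>For \<open>i \<noteq> 0\<close> the product \<open>i * j\<close> runs through all
  exponents, so these terms are multiples of \<tau>; the index \<open>i = 0\<close> contributes
  \<open>CARD('n)\<close> copies of \<open>x\<close>.\<close>

lemma sum_eigen:
  assumes "x \<in> carrier G"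
  obtains y where "(\<Sum>j\<in>UNIV. eigen j x) = of_nat CARD('n) * mon [x] 0 + \<tau> * y"
proof
  have *: "(\<Sum>j\<in>UNIV. mon [y] (- (i * j))) = \<tau> * mon [y] 0" if i: "i \<noteq> 0" for i :: 'n and y :: 'a
  proof -
    obtain k where k: "i * k = 1" using unit[OF i] by auto
    then have k': "i * (k * a) = a" "k * (i * a) = a" for a
      by (metis mult.assoc mult.commute mult_1)+
    have "(\<Sum>j\<in>UNIV. mon [y] (- (i * j))) = (\<Sum>m\<in>UNIV. mon [y] m)"
      by (rule sum.reindex_bij_witness[of _ "\<lambda>m. - (k * m)" "\<lambda>j. - (i * j)"]) (auto simp: k')
    then show ?thesis by (simp add: \<tau>_def sum_distrib_right)
  qed
  have "(\<Sum>j\<in>UNIV. eigen j x) = (\<Sum>i\<in>UNIV. \<Sum>j\<in>UNIV. mon [act i x] (- (i * j)))"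
    unfolding eigen_def by (rule sum.swap)
  also have "\<dots> = (\<Sum>j\<in>(UNIV :: 'n set). mon [act 0 x] 0)
      + (\<Sum>i\<in>UNIV - {0}. \<Sum>j\<in>UNIV. mon [act i x] (- (i * j)))"
    by (subst sum.remove[of UNIV 0]) auto
  also have "(\<Sum>i\<in>UNIV - {0}. \<Sum>j\<in>UNIV. mon [act i x] (- (i * j)))
      = \<tau> * (\<Sum>i\<in>UNIV - {0}. mon [act i x] 0)"
    by (simp add: * sum_distrib_left)
  finally show "(\<Sum>j\<in>UNIV. eigen j x)
      = of_nat CARD('n) * mon [x] 0 + \<tau> * (\<Sum>i\<in>UNIV - {0}. mon [act i x] 0)"
    using assms by (simp add: act_zero)
qed

text \<open>As \<tau> is central, every term of the expanded product except the leading one can be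
  collected into a single multiple of \<tau>.\<close>

lemma prod_sum_eigen:
  assumes "set xs \<subseteq> carrier G"
  shows "\<exists>y. prod_list (map (\<lambda>x. \<Sum>j\<in>UNIV. eigen j x) xs)
    = of_nat (CARD('n) ^ length xs) * mon xs 0 + \<tau> * y"
  using assms
proof (induction xs)
  case Nil
  then show ?case by (auto simp: mono_one intro!: exI[of _ 0])
next
  case (Cons x xs)
  then obtain y where y: "prod_list (map (\<lambda>x. \<Sum>j\<in>UNIV. eigen j x) xs)
    = of_nat (CARD('n) ^ length xs) * mon xs 0 + \<tau> * y" by auto
  obtain z where z: "(\<Sum>j\<in>UNIV. eigen j x) = of_nat CARD('n) * mon [x] 0 + \<tau> * z"
    using sum_eigen Cons.prems by auto
  define n k :: "('a, 'n) npoly" where "n = of_nat CARD('n)" and "k = of_nat (CARD('n) ^ length xs)"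
  have k: "k * a = a * k" for a unfolding k_def by (rule mult_of_nat_commute)
  have "(n * mon [x] 0 + \<tau> * z) * (k * mon xs 0 + \<tau> * y)
      = n * (mon [x] 0 * k) * mon xs 0 + (n * mon [x] 0 * \<tau>) * y + \<tau> * (z * (k * mon xs 0 + \<tau> * y))"
    by (simp add: algebra_simps)
  also have "n * (mon [x] 0 * k) * mon xs 0 = (n * k) * (mon [x] 0 * mon xs 0)"
    by (simp only: k[of "mon [x] 0", symmetric] mult.assoc)
  also have "(n * mon [x] 0 * \<tau>) * y = \<tau> * (n * mon [x] 0 * y)"
    unfolding tau_commute by (simp only: mult.assoc)
  finally have 1: "(n * mon [x] 0 + \<tau> * z) * (k * mon xs 0 + \<tau> * y)
      = n * k * mon (x # xs) 0 + \<tau> * (n * mon [x] 0 * y + z * (k * mon xs 0 + \<tau> * y))"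
    by (simp add: distrib_left add.assoc)
  have 2: "n * k = of_nat (CARD('n) ^ length (x # xs))" by (simp add: n_def k_def)
  show ?case
    unfolding list.map prod_list.Cons y z n_def[symmetric] k_def[symmetric] 1 2 by (rule exI) (rule refl)
qed

lemma torsion_pow:
  assumes "x \<in> carrier G" "x [^] (CARD('n) ^ k) = \<one>"
  shows "x = \<one>"
  using assms
proof (induction k arbitrary: x)
  case 0
  then show ?case by simp
next
  case (Suc k)
  have "(x [^] CARD('n)) [^] (CARD('n) ^ k) = \<one>"
    using Suc.prems by (simp add: nat_pow_pow)
  then have "x [^] CARD('n) = \<one>"
    using Suc.IH[of "x [^] CARD('n)"] Suc.prems(1) by blast
  then show ?case using torsion[OF Suc.prems(1)] by blast
qed

text \<open>The Fourier inversion \<open>n x = \<Sum>\<^sub>j e\<^sub>j(x)\<close> only holds modulo \<open>\<tau> = 1 + t + \<dots> + t\<^sup>n\<^sup>-\<^sup>1\<close>,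
  but \<open>\<tau>\<close> contributes equally to all powers of \<open>t\<close>.\<close>
theorem left_normed_trivial:
  assumes dead: "\<And>s u xs. u \<in> M s \<Longrightarrow> set xs \<subseteq> (\<Union>i. L i) \<Longrightarrow> Suc (length xs) = c \<Longrightarrow> foldl (*) u xs \<in> Z"
    and x: "x \<in> carrier G" "set ys \<subseteq> carrier G" "Suc (length ys) = c"
  shows "foldl comm x ys = \<one>"
proof -
  interpret graded_action M L Z by (rule graded_action_eigen)
  let ?E = "\<lambda>x. \<Sum>j\<in>UNIV. eigen j x"
  have Z0: "0 \<in> Z" using additiveD(1)[OF evt(1)] by (simp add: Z_def)
  have Zsum: "(\<And>j. f j \<in> Z) \<Longrightarrow> sum f A \<in> Z" for f and A :: "'n set"
    by (induction A rule: infinite_finite_induct) (auto intro: Z_add Z0)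
  have foldl_prod: "foldl (*) u zs = u * prod_list zs" for u :: "('a, 'n) npoly" and zs
    by (induction zs arbitrary: u) (auto simp: mult.assoc)
  have step: "u * prod_list zs * prod_list (map ?E vs) \<in> Z"
    if "u \<in> M s" "set zs \<subseteq> (\<Union>i. L i)" "set vs \<subseteq> carrier G" "Suc (length zs + length vs) = c" for u s zs vs
    using that
  proof (induction vs arbitrary: zs)
    case Nil
    then show ?case using dead[of u s zs] by (simp add: foldl_prod)
  next
    case (Cons v vs)
    have "u * prod_list (zs @ [eigen j v]) * prod_list (map ?E vs) \<in> Z" for j
      using Cons.prems eigen_in_L[of v j] by (intro Cons.IH) auto
    then have "(\<Sum>j\<in>UNIV. u * prod_list (zs @ [eigen j v]) * prod_list (map ?E vs)) \<in> Z"
      by (rule Zsum)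
    then show ?case by (simp add: sum_distrib_left sum_distrib_right mult.assoc)
  qed
  have "eigen j x * prod_list (map ?E ys) \<in> Z" for j
    using step[OF eigen_in_M[OF x(1)], of "[]" ys j] x by simp
  then have "(\<Sum>j\<in>UNIV. eigen j x * prod_list (map ?E ys)) \<in> Z" by (rule Zsum)
  then have in_Z: "prod_list (map ?E (x # ys)) \<in> Z" by (simp add: sum_distrib_right)
  define n where "n = CARD('n) ^ length (x # ys)"
  obtain y where y: "prod_list (map ?E (x # ys)) = of_nat n * mon (x # ys) 0 + \<tau> * y"
    using prod_sum_eigen[of "x # ys"] x unfolding n_def by auto
  have eq: "evt m (mon (x # ys) 0) [^] n \<otimes> evt m (\<tau> * y) = \<one>" for m
  proof -
    have "evt m (prod_list (map ?E (x # ys)) * 1) = \<one>" using in_Z unfolding Z_def by blast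
    then show ?thesis
      unfolding y by (simp only: mult_1_right additive_add[OF evt(1)] additive_of_nat[OF evt(1)])
  qed
  \<comment> \<open>The monomial \<open>x # ys\<close> carries exponent 0, so reading off exponent 1
    isolates \<tau> \<open>* y\<close>; its value there is the same as at exponent 0.\<close>
  have "evt 1 (\<tau> * y) = evt 0 (\<tau> * y)"
    using evt_tee[of 1 1 "\<tau> * y"] by (simp add: tee_tau flip: mult.assoc)
  moreover have "evt 1 (mon (x # ys) 0) = \<one>" by (simp add: evt(2))
  ultimately have e0: "evt 0 (\<tau> * y) = \<one>"
    using eq[of 1] additiveD(4)[OF evt(1)] by simp
  have m0: "evt 0 (mon (x # ys) 0) = foldl comm x ys"
    using x by (simp add: evt(2) lnc_def)
  have car: "foldl comm x ys \<in> carrier G"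
    unfolding m0[symmetric] by (rule additiveD(4)[OF evt(1)])
  have pow: "foldl comm x ys [^] n = \<one>"
    using eq[of 0] car unfolding e0 m0 by simp
  show ?thesis by (rule torsion_pow[OF car pow[unfolded n_def]])
qed

end

section \<open>Groups of prime power order and their automorphisms\<close>

text \<open>Points that are not fixed fall into orbits whose length is a positive power of
  \<open>p\<close>. This yields both the centre of a q-group and the distinctness of p and
  q.\<close>

lemma prime_power_action_fixed_points:
  assumes "group_action G E \<phi>" and E: "finite E" and G: "order G = p ^ n" and p: "Factorial_Ring.prime p"
  shows "p dvd card E - card {x \<in> E. \<forall>g\<in>carrier G. \<phi> g x = x}"
proof -
  interpret group_action G E \<phi> by fact
  interpret G: group G using group_hom group_hom.axioms(1) by blast
  let ?F = "{x \<in> E. \<forall>g\<in>carrier G. \<phi> g x = x}"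
  let ?C = "orbit G \<phi> ` (E - ?F)"
  have sub: "orbit G \<phi> x \<subseteq> E" if "x \<in> E" for x
    using that element_image by (auto simp: orbit_def)
  have same: "orbit G \<phi> y = orbit G \<phi> x" if "x \<in> E" "y \<in> orbit G \<phi> x" for x y
    using that sub[of x] sub[of y] orbit_sym orbit_trans by (meson subsetD subsetI subset_antisym)
  have "\<Union>?C = E - ?F"
  proof
    show "E - ?F \<subseteq> \<Union>?C" using orbit_refl by auto
    show "\<Union>?C \<subseteq> E - ?F"
    proof
      fix y assume "y \<in> \<Union>?C"
      then obtain x where x: "x \<in> E" "\<not> (\<forall>g\<in>carrier G. \<phi> g x = x)" and y: "y \<in> orbit G \<phi> x" by blast
      have "x \<in> orbit G \<phi> y" using same[OF x(1) y] orbit_refl[OF x(1)] by simp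
      then have "x = y" if "\<forall>g\<in>carrier G. \<phi> g y = y" using that by (auto simp: orbit_def)
      then have "\<not> (\<forall>g\<in>carrier G. \<phi> g y = y)" using x by blast
      then show "y \<in> E - ?F" using sub x(1) y by auto
    qed
  qed
  moreover have "p dvd card (\<Union>?C)"
  proof (rule dvd_partition)
    show "finite (\<Union>?C)" using calculation E by simp
    show "\<forall>c1\<in>?C. \<forall>c2\<in>?C. c1 \<noteq> c2 \<longrightarrow> c1 \<inter> c2 = {}" using same by blast
    show "\<forall>c\<in>?C. p dvd card c"
    proof
      fix c assume "c \<in> ?C"
      then obtain x where x: "x \<in> E" "\<not> (\<forall>g\<in>carrier G. \<phi> g x = x)" and c: "c = orbit G \<phi> x" by blast
      have "card (orbit G \<phi> x) dvd p ^ n" using orbit_stabilizer_theorem[OF x(1)] G by (metis dvd_triv_left)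
      then obtain k where k: "card (orbit G \<phi> x) = p ^ k" using p divides_primepow_nat by blast
      have "k \<noteq> 0"
      proof
        assume "k = 0"
        then obtain z where "orbit G \<phi> x = {z}" using k card_1_singletonE by (metis power_0)
        then have "\<phi> g x = x" if "g \<in> carrier G" for g
          using orbit_refl[OF x(1)] that by (auto simp: orbit_def)
        then show False using x by auto
      qed
      then show "p dvd card c" by (simp add: c k)
    qed
  qed
  ultimately show ?thesis using E by (simp add: card_Diff_subset)
qed

context group
begin

lemma prime_power_center:
  assumes "order G = q ^ n" and q: "Factorial_Ring.prime q" and "carrier G \<noteq> {\<one>}"
  obtains z where "z \<in> carrier G" "z \<noteq> \<one>" "\<And>g. g \<in> carrier G \<Longrightarrow> g \<otimes> z = z \<otimes> g"
proof -
  define F where "F = {x \<in> carrier G. \<forall>g\<in>carrier G. (\<lambda>h\<in>carrier G. g \<otimes> h \<otimes> inv g) x = x}"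
  have pos: "order G > 0" using assms prime_gt_0_nat by simp
  then have fin: "finite (carrier G)" using order_gt_0_iff_finite by blast
  have "n \<noteq> 0"
  proof
    assume "n = 0"
    then have "card (carrier G) = 1" using assms(1) by (simp add: order_def)
    then show False using assms(3) one_closed by (metis card_1_singletonE singletonD)
  qed
  then have "q dvd card (carrier G)" using assms(1) by (simp add: order_def)
  moreover have "q dvd card (carrier G) - card F"
    unfolding F_def by (rule prime_power_action_fixed_points[OF action_by_conjugation fin assms(1) q])
  moreover have "card F \<le> card (carrier G)" by (rule card_mono) (use fin in \<open>auto simp: F_def\<close>)
  ultimately have "q dvd card F" using dvd_diffD1 by blast
  moreover have one: "\<one> \<in> F" by (simp add: F_def)
  moreover have "finite F" using fin by (simp add: F_def)
  ultimately have "F \<noteq> {\<one>}" using prime_gt_1_nat[OF q] by auto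
  then obtain z where z: "z \<in> F" "z \<noteq> \<one>" using one by blast
  have "g \<otimes> z = z \<otimes> g" if g: "g \<in> carrier G" for g
  proof -
    have "g \<otimes> z \<otimes> inv g = z" using z g by (auto simp: F_def)
    then have "g \<otimes> z \<otimes> inv g \<otimes> g = z \<otimes> g" by simp
    then show ?thesis using z g by (simp add: F_def m_assoc)
  qed
  then show thesis using that z by (auto simp: F_def)
qed

section \<open>The upper central series and nilpotency\<close>

primrec ucs :: "nat \<Rightarrow> 'a set" where
  "ucs 0 = {\<one>}"
| "ucs (Suc n) = {x \<in> carrier G. \<forall>g\<in>carrier G. comm x g \<in> ucs n}"

lemma ucs_normal: "ucs n \<lhd> G" and ucs_subset: "ucs n \<subseteq> ucs (Suc n)"
proof (induction n)
  case 0
  { case 1 show ?case by (simp add: one_is_normal) }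
  { case 2 show ?case by simp }
next
  case (Suc n)
  interpret n: normal "ucs n" G by (rule Suc)
  { case 1
    show ?case
    proof (rule normal_invI)
      show "subgroup (ucs (Suc n)) G"
      proof
        show "x \<otimes> y \<in> ucs (Suc n)" if "x \<in> ucs (Suc n)" "y \<in> ucs (Suc n)" for x y
        proof -
          have "comm (x \<otimes> y) g = inv y \<otimes> comm x g \<otimes> y \<otimes> comm y g" if "g \<in> carrier G" for g
            using that \<open>x \<in> _\<close> \<open>y \<in> _\<close> by (simp add: comm_def word_simps)
          then show ?thesis using that n.inv_op_closed1 by auto
        qed
        show "inv x \<in> ucs (Suc n)" if "x \<in> ucs (Suc n)" for x
        proof -
          have "comm (inv x) g = x \<otimes> inv (comm x g) \<otimes> inv x" if "g \<in> carrier G" for g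
            using that \<open>x \<in> _\<close> by (simp add: comm_def word_simps)
          then show ?thesis using that n.inv_op_closed2 by auto
        qed
      qed auto
      show "g \<otimes> x \<otimes> inv g \<in> ucs (Suc n)" if "g \<in> carrier G" "x \<in> ucs (Suc n)" for g x
      proof -
        have "comm (g \<otimes> x \<otimes> inv g) h = g \<otimes> comm x (inv g \<otimes> h \<otimes> g) \<otimes> inv g" if "h \<in> carrier G" for h
          using that \<open>x \<in> _\<close> \<open>g \<in> _\<close> by (simp add: comm_def word_simps)
        then show ?thesis using that n.inv_op_closed2 by auto
      qed
    qed }
  { case 2
    show ?case using Suc.IH(2) by auto }
qed

text \<open>A nontrivial central element of the quotient by \<open>ucs n\<close> lifts to an element
  of \<open>ucs (Suc n)\<close> outside \<open>ucs n\<close>.\<close>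

lemma ucs_strict:
  assumes "order G = q ^ k" "Factorial_Ring.prime q" "ucs n \<noteq> carrier G"
  shows "ucs n \<subset> ucs (Suc n)"
proof -
  interpret n: normal "ucs n" G by (rule ucs_normal)
  interpret Q: group "G Mod ucs n" by (rule n.factorgroup_is_group)
  have "order (G Mod ucs n) * card (ucs n) = q ^ k"
    using lagrange[OF n.subgroup_axioms] assms(1) by (simp add: FactGroup_def order_def)
  then obtain l where l: "order (G Mod ucs n) = q ^ l"
    using assms(2) divides_primepow_nat by (metis dvd_triv_left)
  have "carrier (G Mod ucs n) \<noteq> {\<one>\<^bsub>G Mod ucs n\<^esub>}"
  proof
    assume eq: "carrier (G Mod ucs n) = {\<one>\<^bsub>G Mod ucs n\<^esub>}"
    have "x \<in> ucs n" if "x \<in> carrier G" for x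
    proof -
      have "ucs n #> x \<in> carrier (G Mod ucs n)" using that by (auto simp: FactGroup_def RCOSETS_def)
      then have "ucs n #> x = ucs n" using eq by (simp add: FactGroup_def)
      then show ?thesis using rcos_self[OF that n.subgroup_axioms] by simp
    qed
    then show False using assms(3) n.subset by auto
  qed
  then obtain z where z: "z \<in> carrier (G Mod ucs n)" "z \<noteq> \<one>\<^bsub>G Mod ucs n\<^esub>"
      "\<And>g. g \<in> carrier (G Mod ucs n) \<Longrightarrow> g \<otimes>\<^bsub>G Mod ucs n\<^esub> z = z \<otimes>\<^bsub>G Mod ucs n\<^esub> g"
    using Q.prime_power_center[OF l assms(2)] by metis
  then obtain x where x: "x \<in> carrier G" "z = ucs n #> x"
    by (auto simp: FactGroup_def RCOSETS_def)
  have "comm x g \<in> ucs n" if g: "g \<in> carrier G" for g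
  proof -
    have "ucs n #> g \<in> carrier (G Mod ucs n)" using g by (auto simp: FactGroup_def RCOSETS_def)
    from z(3)[OF this] have "ucs n #> (g \<otimes> x) = ucs n #> (x \<otimes> g)"
      using x g by (simp add: FactGroup_def n.rcos_sum)
    then have "x \<otimes> g \<in> ucs n #> (g \<otimes> x)"
      using rcos_self[OF _ n.subgroup_axioms, of "x \<otimes> g"] x g by simp
    then obtain u where u: "u \<in> ucs n" "x \<otimes> g = u \<otimes> (g \<otimes> x)" by (auto simp: r_coset_def)
    have "comm x g = inv (g \<otimes> x) \<otimes> (x \<otimes> g)" using x g by (simp add: comm_def word_simps)
    also have "\<dots> = inv (g \<otimes> x) \<otimes> u \<otimes> (g \<otimes> x)" using u x g by (simp add: m_assoc)
    finally show ?thesis using n.inv_op_closed1[of "g \<otimes> x" u] u x g by simp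
  qed
  then have "x \<in> ucs (Suc n)" using x by simp
  moreover have "x \<notin> ucs n"
    using z(2) x coset_join2[OF _ n.subgroup_axioms, of x] by (auto simp: FactGroup_def)
  ultimately show ?thesis using ucs_subset by blast
qed

text \<open>Each strict step of the upper series adds an element, so it exhausts the finite group at
  some \<open>m\<close>; the lower series then descends inside it.\<close>

lemma prime_power_nilpotent:
  assumes "order G = q ^ k" "Factorial_Ring.prime q"
  shows "\<exists>m. lcs m = {\<one>}"
proof -
  have fin: "finite (carrier G)"
    using assms prime_gt_0_nat order_gt_0_iff_finite by (metis zero_less_power)
  have sub: "ucs n \<subseteq> carrier G" for n by (cases n) auto
  have "ucs n = carrier G \<or> n < card (ucs n)" for n
  proof (induction n)
    case (Suc n)
    show ?case
    proof (cases "ucs n = carrier G")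
      case True
      then show ?thesis using ucs_subset[of n] sub[of "Suc n"] by auto
    next
      case False
      have "finite (ucs (Suc n))" using fin sub finite_subset by blast
      then show ?thesis
        using psubset_card_mono[OF _ ucs_strict[OF assms False]] Suc False by auto
    qed
  qed auto
  from this[of "card (carrier G)"] obtain m where m: "ucs m = carrier G"
    using card_mono[OF fin sub[of "card (carrier G)"]] by auto
  have "i \<le> m \<Longrightarrow> lcs i \<subseteq> ucs (m - i)" for i
  proof (induction i)
    case (Suc i)
    then have "m - i = Suc (m - Suc i)" by simp
    then have "comm x y \<in> ucs (m - Suc i)" if "x \<in> lcs i" "y \<in> carrier G" for x y
      using Suc that by auto
    then show ?case by (intro lcs_Suc_least normal_imp_subgroup ucs_normal)
  qed (simp add: m)
  from this[of m] have "lcs m \<subseteq> {\<one>}" by simp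
  moreover have "\<one> \<in> lcs m" using lcs_normal normal_imp_subgroup subgroup.one_closed by metis
  ultimately show ?thesis by blast
qed

text \<open>If the class \<open>c\<close> exceeded \<open>b\<close>, left-normed commutators of
  weight \<open>c\<close> would have \<open>c - 1 \<ge> b\<close> entries after the first and so
  vanish; this would already make \<open>lcs (c - 1)\<close> trivial.\<close>

lemma class_bound:
  fixes act :: "'n::{finite, comm_ring_1} \<Rightarrow> 'a \<Rightarrow> 'a"
  assumes words: "\<And>(M :: 'n \<Rightarrow> ('a, 'n) npoly set) L Z u s xs. graded_action M L Z \<Longrightarrow> u \<in> M s \<Longrightarrow>
      set xs \<subseteq> (\<Union>i. L i) \<Longrightarrow> b \<le> length xs \<Longrightarrow> foldl (*) u xs \<in> Z"
    and nil: "lcs m = {\<one>}"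
    and act: "\<And>i. act i \<in> hom G G" "\<And>x. x \<in> carrier G \<Longrightarrow> act 0 x = x"
      "\<And>i j x. x \<in> carrier G \<Longrightarrow> act (i + j) x = act i (act j x)"
    and norm: "\<And>x. x \<in> carrier G \<Longrightarrow> foldr (\<lambda>i r. act i x \<otimes> r) idx \<one> = \<one>"
      "distinct idx" "set idx = UNIV"
    and torsion: "\<And>x. x \<in> carrier G \<Longrightarrow> x [^] CARD('n) = \<one> \<Longrightarrow> x = \<one>"
    and unit: "\<And>i :: 'n. i \<noteq> 0 \<Longrightarrow> \<exists>k. i * k = 1"
  shows "lcs b = {\<one>}"
proof -
  have one: "\<one> \<in> lcs i" for i using lcs_normal normal_imp_subgroup subgroup.one_closed by metis
  define c where "c = (LEAST m. lcs m = {\<one>})"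
  have c: "lcs c = {\<one>}"
    unfolding c_def by (rule LeastI) (rule nil)
  have least: "c \<le> j" if "lcs j = {\<one>}" for j
    unfolding c_def using that by (rule Least_le)
  have anti: "lcs j \<subseteq> lcs i" if "i \<le> j" for i j
    using lift_Suc_antimono_le[of lcs, OF lcs_Suc_subset that] .
  have "c \<le> b"
  proof (rule ccontr)
    assume "\<not> c \<le> b"
    then have cb: "b < c" by simp
    interpret f: central_filtration G "\<lambda>i. lcs (i - 1)" by (rule lcs_filtration)
    interpret g: graded_lie G "\<lambda>i. lcs (i - 1)" c act idx
    proof (intro graded_lie.intro graded_lie_axioms.intro)
      show "central_filtration G (\<lambda>i. lcs (i - 1))" by (rule lcs_filtration)
      show "1 \<le> c" using cb by simp
      show "lcs (Suc c - 1) = {\<one>}" using c by simp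
    qed (fact act norm torsion unit)+
    \<comment> \<open>Entries are traded for depth: a generator \<open>comm x y\<close> of
      \<open>lcs (Suc i)\<close> followed by \<open>ys\<close> is the element \<open>x\<close> of
      \<open>lcs i\<close> followed by \<open>y # ys\<close>. At \<open>i = c - 1\<close> no entries
      remain.\<close>
    have triv: "foldl comm x ys = \<one>" if "x \<in> lcs i" "set ys \<subseteq> carrier G" "Suc i + length ys = c" for i x ys
      using that
    proof (induction i arbitrary: x ys)
      case 0
      show ?case
      proof (rule g.left_normed_trivial)
        fix s u xs assume *: "u \<in> g.M s" "set xs \<subseteq> (\<Union>i. g.L i)" "Suc (length xs) = c"
        show "foldl (*) u xs \<in> g.Z"
          by (rule words[OF g.graded_action_eigen *(1,2)]) (use *(3) cb in simp)
      qed (use 0 in auto)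
    next
      case (Suc i)
      interpret S: normal "lcs (Suc i)" G by (rule lcs_normal)
      define P where "P = {x \<in> lcs (Suc i). foldl comm x ys = \<one>}"
      \<comment> \<open>The filtration is shifted by one against \<open>lcs\<close>, hence the index
        \<open>Suc (Suc i)\<close> for \<open>lcs (Suc i)\<close>.\<close>
      have mult: "foldl comm (x \<otimes> y) ys = foldl comm x ys \<otimes> foldl comm y ys"
        if "x \<in> lcs (Suc i)" "y \<in> lcs (Suc i)" for x y
        using g.foldl_comm_mult[of x "Suc (Suc i)" y ys] that Suc.prems by auto
      have clo: "foldl comm x ys \<in> carrier G" if "x \<in> carrier G" for x
        using that Suc.prems(2) by (induction ys arbitrary: x) auto
      have "subgroup P G"
      proof
        show "P \<subseteq> carrier G" using S.subset by (auto simp: P_def)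
        show "x \<otimes> y \<in> P" if "x \<in> P" "y \<in> P" for x y
          using that mult by (auto simp: P_def)
        show "\<one> \<in> P" using g.foldl_comm_one[OF Suc.prems(2)] by (simp add: P_def)
        show "inv x \<in> P" if "x \<in> P" for x
        proof -
          have "foldl comm (x \<otimes> inv x) ys = foldl comm x ys \<otimes> foldl comm (inv x) ys"
            using that by (intro mult) (auto simp: P_def)
          then show ?thesis
            using that g.foldl_comm_one[OF Suc.prems(2)] clo[of "inv x"] S.mem_carrier by (auto simp: P_def)
        qed
      qed
      moreover have "comm x y \<in> P" if "x \<in> lcs i" "y \<in> carrier G" for x y
        using that Suc.IH[of x "y # ys"] Suc.prems comm_lcs by (auto simp: P_def)
      ultimately have "lcs (Suc i) \<subseteq> P" by (rule lcs_Suc_least)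
      then show ?case using Suc.prems by (auto simp: P_def)
    qed
    have "x = \<one>" if "x \<in> lcs (c - 1)" for x
      using triv[OF that, of "[]"] cb by simp
    then have "lcs (c - 1) = {\<one>}" using one[of "c - 1"] by blast
    then show False using least[of "c - 1"] cb by simp
  qed
  then show ?thesis using anti[of c b] c one[of b] by blast
qed

section \<open>Fixed-point-free automorphisms\<close>

lemma fixed_point_free_surj:
  assumes fin: "finite (carrier G)" and f: "f \<in> hom G G"
    and free: "\<And>x. x \<in> carrier G \<Longrightarrow> f x = x \<Longrightarrow> x = \<one>"
  shows "(\<lambda>y. inv y \<otimes> f y) ` carrier G = carrier G"
proof (rule endo_inj_surj[OF fin])
  interpret f: group_hom G G f using f by unfold_locales
  show "(\<lambda>y. inv y \<otimes> f y) ` carrier G \<subseteq> carrier G" by auto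
  show "inj_on (\<lambda>y. inv y \<otimes> f y) (carrier G)"
  proof (rule inj_onI)
    fix y z assume yz: "y \<in> carrier G" "z \<in> carrier G" and eq: "inv y \<otimes> f y = inv z \<otimes> f z"
    have "f y = y \<otimes> (inv z \<otimes> f z)" using yz eq[symmetric] by simp
    then have "f (y \<otimes> inv z) = y \<otimes> inv z" using yz by (simp add: m_assoc)
    then have "y \<otimes> inv z = \<one>" by (rule free[rotated]) (use yz in simp)
    then have "y \<otimes> inv z \<otimes> z = z" using yz by simp
    then show "y = z" using yz by (simp add: m_assoc)
  qed
qed

lemma funpow_hom: "f \<in> hom G G \<Longrightarrow> f ^^ k \<in> hom G G"
  by (induction k) (auto simp: hom_def Pi_iff)

text \<open>With \<open>x = inv y \<otimes> f y\<close> the product telescopes to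
  \<open>inv y \<otimes> (f ^^ p) y\<close>.\<close>

lemma fixed_point_free_norm:
  assumes fin: "finite (carrier G)" and f: "f \<in> hom G G"
    and free: "\<And>x. x \<in> carrier G \<Longrightarrow> f x = x \<Longrightarrow> x = \<one>"
    and period: "\<And>x. x \<in> carrier G \<Longrightarrow> (f ^^ p) x = x" and x: "x \<in> carrier G"
  shows "foldr (\<lambda>k r. (f ^^ k) x \<otimes> r) [0..<p] \<one> = \<one>"
proof -
  obtain y where y: "y \<in> carrier G" "x = inv y \<otimes> f y"
    using fixed_point_free_surj[OF fin f free] x by blast
  have "foldr (\<lambda>k r. (f ^^ k) x \<otimes> r) [0..<n] r = inv y \<otimes> (f ^^ n) y \<otimes> r" if "r \<in> carrier G" for n r
    using that
  proof (induction n arbitrary: r)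
    case (Suc n)
    interpret fn: group_hom G G "f ^^ n" using funpow_hom[OF f] by unfold_locales
    have fy: "f y \<in> carrier G" using f y by (auto simp: hom_def)
    then have "(f ^^ n) y \<in> carrier G" "(f ^^ n) (f y) \<in> carrier G" using y by auto
    moreover have "(f ^^ n) (f y) = (f ^^ Suc n) y" by (simp add: funpow_swap1)
    ultimately show ?case using Suc y fy by (simp add: m_assoc del: funpow.simps)
  qed (use y in simp)
  from this[of \<one> p] show ?thesis using y period by simp
qed

end

lemma of_nat_eq_iff_CHAR: "(of_nat a :: 'n::comm_ring_1) = of_nat b \<longleftrightarrow> a mod CHAR('n) = b mod CHAR('n)"
proof (induction a b rule: linorder_wlog)
  case (le a b)
  have "(of_nat a :: 'n) = of_nat b \<longleftrightarrow> of_nat (b - a) = (0 :: 'n)"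
    using le by (auto simp: of_nat_diff)
  then show ?case using le by (metis of_nat_eq_0_iff_char_dvd mod_eq_dvd_iff_nat)
qed metis

context group
begin

text \<open>A residue \<open>i\<close> acts as \<open>f ^^ k\<close> for a representative
  \<open>k\<close>; the period \<open>p\<close> makes the choice immaterial. There is no p-torsion
  because \<open>p\<close> is coprime to the group order.\<close>

lemma fixed_point_free_class_bound:
  fixes f :: "'a \<Rightarrow> 'a" and p :: nat
  assumes words: "\<And>(M :: 'n::{finite, comm_ring_1} \<Rightarrow> ('a, 'n) npoly set) L Z u s xs. graded_action M L Z \<Longrightarrow>
      u \<in> M s \<Longrightarrow> set xs \<subseteq> (\<Union>i. L i) \<Longrightarrow> b \<le> length xs \<Longrightarrow> foldl (*) u xs \<in> Z"
    and unit: "\<And>i :: 'n. i \<noteq> 0 \<Longrightarrow> \<exists>k. i * k = 1"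
    and card: "CARD('n) = p" "CHAR('n) = p" and p: "Factorial_Ring.prime p"
    and q: "order G = q ^ n" "Factorial_Ring.prime q" "p \<noteq> q"
    and f: "f \<in> hom G G" and free: "\<And>x. x \<in> carrier G \<Longrightarrow> f x = x \<Longrightarrow> x = \<one>"
    and period: "\<And>x. x \<in> carrier G \<Longrightarrow> (f ^^ p) x = x"
  shows "lcs b = {\<one>}"
proof -
  have fin: "finite (carrier G)"
    using q prime_gt_0_nat order_gt_0_iff_finite by (metis zero_less_power)
  define idx :: "'n list" where "idx = map of_nat [0..<p]"
  have idx: "distinct idx" "set idx = UNIV"
  proof -
    have inj: "inj_on (of_nat :: nat \<Rightarrow> 'n) {0..<p}"
      by (auto simp: inj_on_def of_nat_eq_iff_CHAR card)
    then show "distinct idx" by (simp add: idx_def distinct_map)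
    have "card ((of_nat :: nat \<Rightarrow> 'n) ` {0..<p}) = CARD('n)"
      using inj by (simp add: card_image card)
    then have "(of_nat :: nat \<Rightarrow> 'n) ` {0..<p} = UNIV"
      by (intro card_subset_eq) auto
    then show "set idx = UNIV" by (simp add: idx_def)
  qed
  define e :: "'n \<Rightarrow> nat" where "e i = (SOME k. of_nat k = i)" for i
  have e: "of_nat (e i) = i" for i
  proof -
    have "i \<in> set idx" using idx by simp
    then have "\<exists>k. of_nat k = i" by (auto simp: idx_def)
    then show ?thesis unfolding e_def by (rule someI_ex)
  qed
  define act where "act i = f ^^ e i" for i
  have act: "act (of_nat k) x = (f ^^ k) x" if "x \<in> carrier G" for k x
  proof -
    have "e (of_nat k) mod p = k mod p"
      using e[of "of_nat k"] unfolding of_nat_eq_iff_CHAR card .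
    then show ?thesis
      using funpow_mod_eq[OF period[OF that]] unfolding act_def by metis
  qed
  obtain m where m: "lcs m = {\<one>}" using prime_power_nilpotent[OF q(1,2)] by blast
  show ?thesis
  proof (rule class_bound[OF words m])
    show "act i \<in> hom G G" for i unfolding act_def by (rule funpow_hom[OF f])
    show "act 0 x = x" if "x \<in> carrier G" for x using act[OF that, of 0] by simp
    show "act (i + j) x = act i (act j x)" if "x \<in> carrier G" for i j x
    proof -
      have "act (i + j) x = (f ^^ (e i + e j)) x"
        using act[OF that, of "e i + e j"] by (simp add: e)
      then show ?thesis by (simp add: act_def funpow_add)
    qed
    show "foldr (\<lambda>i r. act i x \<otimes> r) idx \<one> = \<one>" if "x \<in> carrier G" for x
      using fixed_point_free_norm[OF fin f free period that] act[OF that]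
      by (simp add: idx_def foldr_map comp_def)
    show "x = \<one>" if x: "x \<in> carrier G" "x [^] CARD('n) = \<one>" for x
    proof -
      have "ord x dvd p" using x pow_eq_id card by metis
      moreover have "ord x dvd q ^ n" using ord_dvd_group_order[OF x(1)] q(1) by simp
      moreover have "coprime p (q ^ n)" using p q primes_coprime by auto
      ultimately have "ord x = 1" using coprime_common_divisor_nat by blast
      then show ?thesis using ord_eq_1 x by blast
    qed
  qed (use idx unit in auto)
qed

lemma units_3: "(i :: 3) \<noteq> 0 \<Longrightarrow> \<exists>k. i * k = 1"
proof -
  assume i: "i \<noteq> 0"
  obtain z where "i = of_int z" "0 \<le> z" "z < 3" by (cases i rule: bit1.cases) auto
  moreover from this have "z = 0 \<or> z = 1 \<or> z = 2" by auto
  ultimately have "i = 1 \<or> i = 2" using i by auto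
  moreover have "(1 :: 3) * 1 = 1" "(2 :: 3) * 2 = 1" by simp_all
  ultimately show ?thesis by metis
qed

lemma units_5: "(i :: 5) \<noteq> 0 \<Longrightarrow> \<exists>k. i * k = 1"
proof -
  assume i: "i \<noteq> 0"
  obtain z where "i = of_int z" "0 \<le> z" "z < 5" by (cases i rule: bit1.cases) auto
  moreover from this have "z = 0 \<or> z = 1 \<or> z = 2 \<or> z = 3 \<or> z = 4" by auto
  ultimately have "i = 1 \<or> i = 2 \<or> i = 3 \<or> i = 4" using i by auto
  moreover have "(1 :: 5) * 1 = 1" "(2 :: 5) * 3 = 1" "(3 :: 5) * 2 = 1" "(4 :: 5) * 4 = 1" by simp_all
  ultimately show ?thesis by metis
qed

lemma fixed_point_free_3:
  assumes "order G = q ^ n" "Factorial_Ring.prime q" "q \<noteq> 3"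
    and "f \<in> hom G G" "\<And>x. x \<in> carrier G \<Longrightarrow> f x = x \<Longrightarrow> x = \<one>"
    and "\<And>x. x \<in> carrier G \<Longrightarrow> (f ^^ 3) x = x"
  shows "lcs 2 = {\<one>}"
proof (rule fixed_point_free_class_bound[where 'n = 3 and f = f and p = 3])
  fix M L :: "3 \<Rightarrow> ('a, 3) npoly set" and Z u s xs
  assume ga: "graded_action M L Z" and prems: "u \<in> M s" "set xs \<subseteq> (\<Union>i. L i)" "2 \<le> length xs"
  interpret graded_action3 M L Z using ga by (rule graded_action3.intro)
  show "foldl (*) u xs \<in> Z" by (rule long_words_dead[OF length_two_killed units_3 prems])
qed (use assms units_3 in auto)

lemma fixed_point_free_5:
  assumes "order G = q ^ n" "Factorial_Ring.prime q" "q \<noteq> 5"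
    and "f \<in> hom G G" "\<And>x. x \<in> carrier G \<Longrightarrow> f x = x \<Longrightarrow> x = \<one>"
    and "\<And>x. x \<in> carrier G \<Longrightarrow> (f ^^ 5) x = x"
  shows "lcs 6 = {\<one>}"
proof (rule fixed_point_free_class_bound[where 'n = 5 and f = f and p = 5])
  fix M L :: "5 \<Rightarrow> ('a, 5) npoly set" and Z u s xs
  assume ga: "graded_action M L Z" and prems: "u \<in> M s" "set xs \<subseteq> (\<Union>i. L i)" "6 \<le> length xs"
  interpret graded_action5 M L Z using ga by (rule graded_action5.intro)
  show "foldl (*) u xs \<in> Z" by (rule long_words_dead[OF length_six_killed units_5 prems])
qed (use assms units_5 in auto)

end

context group
begin

section \<open>Hughes subgroups for the primes two and three\<close>

lemma commute_inv:
  assumes "a \<in> carrier G" "b \<in> carrier G" "a \<otimes> b = b \<otimes> a"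
  shows "inv a \<otimes> b = b \<otimes> inv a"
proof -
  have "b \<otimes> inv a = inv a \<otimes> (a \<otimes> b) \<otimes> inv a" using assms(1,2) by (simp add: m_assoc)
  also have "\<dots> = inv a \<otimes> (b \<otimes> a) \<otimes> inv a" by (simp only: assms(3))
  also have "\<dots> = inv a \<otimes> b" using assms(1,2) by (simp add: m_assoc)
  finally show ?thesis by simp
qed

text \<open>From \<open>(k \<otimes> g) [^] 2 = \<one>\<close> every \<open>g\<close> outside
  \<open>H\<close> inverts \<open>H\<close> by conjugation. If \<open>x\<close>, \<open>y\<close>
  and \<open>x \<otimes> y\<close> were all outside, \<open>h\<close> would be both inverted and
  centralised by \<open>x \<otimes> y\<close>.\<close>

lemma involutions_outside:
  assumes H: "H \<lhd> G" and out: "\<And>x. x \<in> carrier G - H \<Longrightarrow> x [^] (2::nat) = \<one>"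
    and h: "h \<in> H" "h [^] (2::nat) \<noteq> \<one>" and x: "x \<in> carrier G - H" and y: "y \<in> carrier G - H"
  shows "x \<otimes> y \<in> H"
proof (rule ccontr)
  interpret H: normal H G by (rule H)
  assume xy: "x \<otimes> y \<notin> H"
  have hc: "h \<in> carrier G" using h by auto
  have inverts: "inv g \<otimes> k \<otimes> g = inv k" if g: "g \<in> carrier G - H" and k: "k \<in> H" for g k
  proof -
    have kc: "k \<in> carrier G" using k by auto
    have "k \<otimes> g \<notin> H"
    proof
      assume "k \<otimes> g \<in> H"
      then have "inv k \<otimes> (k \<otimes> g) \<in> H" using k by blast
      then show False using g kc by simp
    qed
    then have "(k \<otimes> g) [^] (2::nat) = \<one>" using out[of "k \<otimes> g"] g kc by simp
    then have "(k \<otimes> g) \<otimes> (k \<otimes> g) = \<one>" using g kc by (simp add: numeral_2_eq_2)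
    then have "k \<otimes> (g \<otimes> k \<otimes> g) = \<one>" using g kc by (simp add: m_assoc)
    then have "inv k \<otimes> (k \<otimes> (g \<otimes> k \<otimes> g)) = inv k \<otimes> \<one>" by simp
    then have 1: "g \<otimes> k \<otimes> g = inv k" using g kc by simp
    have "g \<otimes> g = \<one>" using out[OF g] g by (simp add: numeral_2_eq_2)
    then have "inv g = g" using g by (intro inv_equality) auto
    then show ?thesis using 1 by simp
  qed
  have "inv (x \<otimes> y) \<otimes> h \<otimes> (x \<otimes> y) = inv y \<otimes> (inv x \<otimes> h \<otimes> x) \<otimes> y"
    using x y hc by (simp add: word_simps)
  also have "\<dots> = inv y \<otimes> inv h \<otimes> y" using inverts[OF x h(1)] by simp
  also have "\<dots> = h" using inverts[OF y, of "inv h"] h(1) hc by simp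
  finally have "inv h = h" using inverts[of "x \<otimes> y" h] x y xy h(1) by simp
  then have "h \<otimes> h = \<one>" using hc r_inv by metis
  then show False using h(2) hc by (simp add: numeral_2_eq_2)
qed

text \<open>An element \<open>k\<close> of \<open>H\<close> commutes with all its conjugates, so its normal closure is an abelian group
  on which \<open>1 + g + g\<^sup>-\<^sup>1 = 0\<close> for every \<open>g \<notin> H\<close>. These relations for \<open>g = x, y, x y, x\<^sup>-\<^sup>1 y\<close> combine to \<open>3 = 0\<close>.\<close>
lemma cube_outside:
  assumes H: "H \<lhd> G" and out: "\<And>x. x \<in> carrier G - H \<Longrightarrow> x [^] (3::nat) = \<one>"
    and h: "h \<in> H" and x: "x \<in> carrier G - H" and y: "y \<in> carrier G - H"
    and xy: "x \<otimes> y \<notin> H" "inv x \<otimes> y \<notin> H"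
  shows "h [^] (3::nat) = \<one>"
proof -
  interpret H: normal H G by (rule H)
  define C where "C a k = a \<otimes> k \<otimes> inv a" for a k
  have C_H: "C a k \<in> H" if "a \<in> carrier G" "k \<in> H" for a k
    using that H.inv_op_closed2 by (simp add: C_def)
  have C_C: "C a (C b k) = C (a \<otimes> b) k" if "a \<in> carrier G" "b \<in> carrier G" "k \<in> H" for a b k
    using that by (simp add: C_def word_simps)
  have Hc: "k \<in> carrier G" if "k \<in> H" for k using that by auto
  \<comment> \<open>This is \<open>(k \<otimes> g) [^] 3 = \<one>\<close> rewritten with
    \<open>g [^] 3 = \<one>\<close>, that is, \<open>g \<otimes> g = inv g\<close>.\<close>
  have cube: "k \<otimes> C g k \<otimes> C (inv g) k = \<one>" if g: "g \<in> carrier G - H" and k: "k \<in> H" for g k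
  proof -
    have gc: "g \<in> carrier G" and kc: "k \<in> carrier G" using g k by auto
    have "k \<otimes> g \<notin> H"
    proof
      assume "k \<otimes> g \<in> H"
      then have "inv k \<otimes> (k \<otimes> g) \<in> H" using k by blast
      then show False using g kc by simp
    qed
    then have "(k \<otimes> g) [^] (3::nat) = \<one>" using out[of "k \<otimes> g"] gc kc by simp
    then have 1: "k \<otimes> g \<otimes> k \<otimes> g \<otimes> k \<otimes> g = \<one>" using gc kc by (simp add: numeral_3_eq_3 m_assoc)
    have "g \<otimes> g \<otimes> g = \<one>" using out[OF g] gc by (simp add: numeral_3_eq_3 m_assoc)
    then have gg: "inv g = g \<otimes> g" using gc by (intro inv_equality) auto
    have "C (inv g) k = inv g \<otimes> k \<otimes> g"
      using gc kc by (simp add: C_def)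
    also have "\<dots> = (g \<otimes> g) \<otimes> k \<otimes> g" by (simp only: gg)
    finally have "C (inv g) k = (g \<otimes> g) \<otimes> k \<otimes> g" .
    moreover have "inv g \<otimes> (g \<otimes> g) = g" using gc by simp
    ultimately have "k \<otimes> C g k \<otimes> C (inv g) k = k \<otimes> g \<otimes> k \<otimes> g \<otimes> k \<otimes> g"
      using gc kc by (simp add: C_def word_simps)
    then show ?thesis using 1 by simp
  qed
  \<comment> \<open>Applying \<open>cube\<close> to both \<open>g\<close> and \<open>inv g\<close>
    gives the product of the other two conjugates in either order.\<close>
  have commute1: "k \<otimes> C g k = C g k \<otimes> k" if g: "g \<in> carrier G - H" and k: "k \<in> H" for g k
  proof -
    have gc: "g \<in> carrier G" "inv g \<in> carrier G - H" and kc: "k \<in> carrier G"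
      using g k H.m_inv_closed[of "inv g"] by auto
    define a b where "a = C g k" and "b = C (inv g) k"
    have ab: "a \<in> carrier G" "b \<in> carrier G" using gc k C_H Hc by (auto simp: a_def b_def)
    have "k \<otimes> a \<otimes> b = \<one>" "k \<otimes> b \<otimes> a = \<one>"
      using cube[OF g k] cube[OF gc(2) k] g by (simp_all add: a_def b_def)
    then have "inv k = a \<otimes> b" "inv k = b \<otimes> a"
      using ab kc by (metis inv_equality inv_inv m_assoc m_closed inv_closed)+
    then have "inv k \<otimes> a = a \<otimes> inv k" using ab by (metis m_assoc)
    then have "k \<otimes> (inv k \<otimes> a) \<otimes> k = k \<otimes> (a \<otimes> inv k) \<otimes> k" by simp
    then show ?thesis using ab kc by (simp add: m_assoc a_def)
  qed
  have commute2: "k \<otimes> C a k = C a k \<otimes> k" if a: "a \<in> carrier G" and k: "k \<in> H" for a k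
  proof (cases "a \<in> H")
    case False
    then show ?thesis using commute1 that by blast
  next
    case True
    have kc: "k \<in> carrier G" using k by auto
    \<comment> \<open>For \<open>a\<close> in \<open>H\<close> the element
      \<open>inv a \<otimes> g\<close> is again outside, and conjugating \<open>commute1\<close> by
      \<open>a\<close> gives the claim. With \<open>g = x\<close> and \<open>g = inv x\<close>,
      \<open>C a k\<close> commutes with \<open>u\<close> and \<open>v\<close>, hence with
      \<open>k = inv (u \<otimes> v)\<close>.\<close>
    have part: "C a k \<otimes> C g k = C g k \<otimes> C a k" if g: "g \<in> carrier G - H" for g
    proof -
      have "inv a \<otimes> g \<notin> H"
      proof
        assume "inv a \<otimes> g \<in> H"
        then have "a \<otimes> (inv a \<otimes> g) \<in> H" using True by blast
        then show False using g a by simp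
      qed
      then have "k \<otimes> C (inv a \<otimes> g) k = C (inv a \<otimes> g) k \<otimes> k" using commute1 k a g by simp
      then have "a \<otimes> (k \<otimes> C (inv a \<otimes> g) k) \<otimes> inv a = a \<otimes> (C (inv a \<otimes> g) k \<otimes> k) \<otimes> inv a" by simp
      then show ?thesis using a g kc by (simp add: C_def word_simps)
    qed
    have xs: "inv x \<in> carrier G - H" using x H.m_inv_closed[of "inv x"] by auto
    define u v w where "u = C x k" and "v = C (inv x) k" and "w = C a k"
    have uvw: "u \<in> carrier G" "v \<in> carrier G" "w \<in> carrier G"
      using x a k C_H Hc by (auto simp: u_def v_def w_def)
    have "w \<otimes> u = u \<otimes> w" "w \<otimes> v = v \<otimes> w" using part[OF x] part[OF xs] by (simp_all add: u_def v_def w_def)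
    moreover have "k \<otimes> u \<otimes> v = \<one>" using cube[OF x k] by (simp add: u_def v_def)
    then have "k = inv (u \<otimes> v)" using uvw kc by (metis inv_equality m_assoc m_closed)
    moreover have "w \<otimes> (u \<otimes> v) = (u \<otimes> v) \<otimes> w" using calculation(1,2) uvw by (metis m_assoc)
    then have "inv (u \<otimes> v) \<otimes> w = w \<otimes> inv (u \<otimes> v)" using uvw by (intro commute_inv) auto
    ultimately show ?thesis by (simp add: w_def)
  qed
  have commute: "C a h \<otimes> C b h = C b h \<otimes> C a h" if "a \<in> carrier G" "b \<in> carrier G" for a b
  proof -
    have "C a h \<otimes> C (b \<otimes> inv a) (C a h) = C (b \<otimes> inv a) (C a h) \<otimes> C a h"
      using commute2 C_H that h by simp
    then show ?thesis using that h by (simp add: C_C m_assoc)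
  qed
  have xc: "x \<in> carrier G" "y \<in> carrier G" using x y by auto
  have rel: "C a h \<otimes> C (g \<otimes> a) h \<otimes> C (inv g \<otimes> a) h = \<one>" if "g \<in> carrier G - H" "a \<in> carrier G" for g a
    using cube[OF that(1) C_H[OF that(2) h]] that h by (simp add: C_C)
  define S Y P Q where "S = C x h" and "Y = C y h" and "P = C (x \<otimes> y) h" and "Q = C (y \<otimes> x) h"
  have car: "S \<in> carrier G" "Y \<in> carrier G" "P \<in> carrier G" "Q \<in> carrier G" "h \<in> carrier G"
    using C_H Hc xc h by (auto simp: S_def Y_def P_def Q_def)
  have solve: "c = inv (a \<otimes> b)" if "a \<otimes> b \<otimes> c = \<one>" "a \<in> carrier G" "b \<in> carrier G" "c \<in> carrier G" for a b c
    using that by (metis inv_equality inv_inv m_closed inv_closed)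
  have Cc: "C a h \<in> carrier G" if "a \<in> carrier G" for a using C_H[OF that h] by auto
  have 1: "C (inv x) h = inv (h \<otimes> S)"
    by (rule solve) (use cube[OF x h] xc Cc car in \<open>auto simp: S_def\<close>)
  have 2: "C (y \<otimes> inv x) h = inv (Y \<otimes> Q)"
  proof -
    have "C y (h \<otimes> S \<otimes> C (inv x) h) = \<one>" using cube[OF x h] xc by (simp add: S_def C_def)
    moreover have "C y (h \<otimes> S \<otimes> C (inv x) h) = Y \<otimes> Q \<otimes> C (y \<otimes> inv x) h"
      using xc car by (simp add: S_def Y_def Q_def C_def word_simps)
    ultimately show ?thesis by (intro solve) (use xc car Cc in auto)
  qed
  have 3: "C (inv y \<otimes> inv x) h = inv (C (inv x) h \<otimes> C (y \<otimes> inv x) h)"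
    by (rule solve) (use rel[OF y, of "inv x"] xc Cc in auto)
  have 4: "C (inv (x \<otimes> y)) h = inv (h \<otimes> P)"
    by (rule solve) (use cube[of "x \<otimes> y" h] xy h xc Cc car in \<open>auto simp: P_def\<close>)
  have 5: "C (inv x \<otimes> y) h = inv (Y \<otimes> P)"
    by (rule solve) (use rel[OF x, of y] xc Cc in \<open>auto simp: P_def Y_def\<close>)
  have 6: "C (inv y \<otimes> x) h = inv (S \<otimes> Q)"
    by (rule solve) (use rel[OF y, of x] xc Cc in \<open>auto simp: Q_def S_def\<close>)
  have 7: "C (inv (inv x \<otimes> y)) h = inv (h \<otimes> C (inv x \<otimes> y) h)"
    by (rule solve) (use cube[of "inv x \<otimes> y" h] xy h xc Cc car in auto)
  \<comment> \<open>Two conjugates of \<open>h\<close> have been computed in two ways. Additively,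
    \<open>A\<close> will say h = S + Q + Y + P and \<open>B\<close> will say 2h + S + Y + P + Q =
    0, so 3h = 0.\<close>
  have "inv (inv x \<otimes> y) = inv y \<otimes> x" "inv (x \<otimes> y) = inv y \<otimes> inv x"
    using xc by (simp_all add: inv_mult_group)
  then have A: "inv (S \<otimes> Q) = inv (h \<otimes> inv (Y \<otimes> P))" and B: "inv (h \<otimes> P) = inv (inv (h \<otimes> S) \<otimes> inv (Y \<otimes> Q))"
    using 1 2 3 4 5 6 7 by simp_all
  have A: "S \<otimes> Q = h \<otimes> inv (Y \<otimes> P)" using inv_inv A car by (metis inv_closed m_closed)
  have B: "h \<otimes> P = inv (h \<otimes> S) \<otimes> inv (Y \<otimes> Q)" using inv_inv B car by (metis inv_closed m_closed)
  have com: "h \<otimes> S = S \<otimes> h" "h \<otimes> Y = Y \<otimes> h" "h \<otimes> P = P \<otimes> h" "h \<otimes> Q = Q \<otimes> h"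
      "S \<otimes> Y = Y \<otimes> S" "S \<otimes> P = P \<otimes> S" "S \<otimes> Q = Q \<otimes> S" "Y \<otimes> P = P \<otimes> Y" "Y \<otimes> Q = Q \<otimes> Y" "P \<otimes> Q = Q \<otimes> P"
    using commute2[OF _ h] commute xc by (simp_all add: S_def Y_def P_def Q_def)
  have h_eq: "h = S \<otimes> Q \<otimes> (Y \<otimes> P)"
    unfolding A using car by (simp add: m_assoc)
  have "Y \<otimes> Q \<otimes> (h \<otimes> S) \<otimes> (h \<otimes> P) = \<one>"
    unfolding B using car by (simp add: word_simps)
  moreover have "Y \<otimes> Q \<otimes> (h \<otimes> S) \<otimes> (h \<otimes> P) = h \<otimes> (h \<otimes> (S \<otimes> Q \<otimes> (Y \<otimes> P)))"
  proof -
    have lc: "b \<otimes> (a \<otimes> c) = a \<otimes> (b \<otimes> c)" if "a \<otimes> b = b \<otimes> a" "a \<in> carrier G" "b \<in> carrier G" "c \<in> carrier G" for a b c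
      using that by (metis m_assoc)
    have "Y \<otimes> Q \<otimes> (h \<otimes> S) \<otimes> (h \<otimes> P) = Y \<otimes> (Q \<otimes> (h \<otimes> (S \<otimes> (h \<otimes> P))))"
      using car by (simp add: m_assoc)
    also have "S \<otimes> (h \<otimes> P) = h \<otimes> (S \<otimes> P)" using lc[of h S P] com car by simp
    also have "Q \<otimes> (h \<otimes> (h \<otimes> (S \<otimes> P))) = h \<otimes> (h \<otimes> (S \<otimes> (Q \<otimes> P)))"
      using lc[of h Q "h \<otimes> (S \<otimes> P)"] lc[of h Q "S \<otimes> P"] lc[of S Q P] com car by simp
    also have "Y \<otimes> (h \<otimes> (h \<otimes> (S \<otimes> (Q \<otimes> P)))) = h \<otimes> (h \<otimes> (S \<otimes> (Q \<otimes> (Y \<otimes> P))))"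
      using lc[of h Y "h \<otimes> (S \<otimes> (Q \<otimes> P))"] lc[of h Y "S \<otimes> (Q \<otimes> P)"] lc[of S Y "Q \<otimes> P"] lc[of Q Y P] com car by simp
    finally show ?thesis using car by (simp add: m_assoc)
  qed
  ultimately have "h \<otimes> (h \<otimes> h) = \<one>" using h_eq by simp
  then show ?thesis using car by (simp add: numeral_3_eq_3 m_assoc)
qed

end

section \<open>Frobenius groups\<close>

context group
begin

lemma fixed_point_free_escapes:
  assumes "finite (carrier G)" "f \<in> hom G G" "\<And>x. x \<in> carrier G \<Longrightarrow> f x = x \<Longrightarrow> x = \<one>"
    and "H \<subseteq> carrier G" "H \<noteq> carrier G"
  shows "\<exists>x\<in>carrier G. inv x \<otimes> f x \<notin> H"
proof (rule ccontr)
  assume "\<not> ?thesis"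
  then have "(\<lambda>y. inv y \<otimes> f y) ` carrier G \<subseteq> H" by auto
  then have "carrier G \<subseteq> H" by (simp only: fixed_point_free_surj[OF assms(1-3)])
  then show False using assms(4,5) by simp
qed

theorem fixed_point_free_hughes_bound:
  assumes q: "order G = q ^ n" "Factorial_Ring.prime q" and p: "Factorial_Ring.prime p" "p \<noteq> q"
    and f: "f \<in> hom G G" and free: "\<And>x. x \<in> carrier G \<Longrightarrow> f x = x \<Longrightarrow> x = \<one>"
    and period: "\<And>x. x \<in> carrier G \<Longrightarrow> (f ^^ p) x = x"
    and nonab: "\<not> comm_group G"
    and H: "H \<lhd> G" "H \<noteq> carrier G" and fH: "\<And>x. x \<in> H \<Longrightarrow> f x \<in> H"
    and out: "\<And>x. x \<in> carrier G - H \<Longrightarrow> x [^] q = \<one>" and h: "h \<in> H" "h [^] q \<noteq> \<one>"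
  shows "p \<ge> 7 \<and> q \<ge> 5"
proof -
  interpret H: normal H G by (rule H)
  interpret f: group_hom G G f using f by unfold_locales
  have fin: "finite (carrier G)"
    using q prime_gt_0_nat order_gt_0_iff_finite by (metis zero_less_power)
  have "p \<noteq> 2"
  proof
    assume p2: "p = 2"
    \<comment> \<open>The norm has only two factors here, so \<open>f\<close> is inversion; a
      homomorphism that inverts makes the group abelian.\<close>
    have inv_f: "f x = inv x" if x: "x \<in> carrier G" for x
    proof -
      have "x \<otimes> f x = \<one>"
        using fixed_point_free_norm[OF fin f free period x] x unfolding p2 by (simp add: numeral_2_eq_2)
      then have "inv x \<otimes> (x \<otimes> f x) = inv x \<otimes> \<one>" by simp
      then show ?thesis using x by simp
    qed
    have "x \<otimes> y = y \<otimes> x" if xy: "x \<in> carrier G" "y \<in> carrier G" for x y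
    proof -
      have "inv (y \<otimes> x) = f x \<otimes> f y" using xy by (simp add: inv_mult_group inv_f)
      also have "\<dots> = f (x \<otimes> y)" using xy by simp
      also have "\<dots> = inv (x \<otimes> y)" using xy by (intro inv_f) simp
      finally have "inv (inv (y \<otimes> x)) = inv (inv (x \<otimes> y))" by simp
      then show ?thesis using xy by simp
    qed
    then have "comm_group G" by (intro group_comm_groupI) auto
    then show False using nonab by simp
  qed
  then have p3: "p \<ge> 3" "odd p" using p(1) prime_ge_2_nat[of p] prime_odd_nat[of p] by auto
  have f_pow_H: "(f ^^ k) x \<in> H" if "x \<in> H" for k x
    using that fH by (induction k) auto
  have f_out: "f x \<notin> H" if x: "x \<in> carrier G" "x \<notin> H" for x
  proof
    assume "f x \<in> H"
    then have "(f ^^ (p - 1)) (f x) \<in> H" by (rule f_pow_H)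
    moreover have "(f ^^ (p - 1)) (f x) = (f ^^ p) x"
      using p3(1) by (cases p) (simp_all add: funpow_swap1)
    ultimately show False using period x by simp
  qed
  have "q \<noteq> 2"
  proof
    assume q2: "q = 2"
    obtain x where x: "x \<in> carrier G" "inv x \<otimes> f x \<notin> H"
      using fixed_point_free_escapes[OF fin f free H.subset H(2)] by blast
    show False
    proof (cases "x \<in> H")
      case True
      then show False using x fH by blast
    next
      case False
      then have "inv x \<in> carrier G - H" "f x \<in> carrier G - H"
        using x f_out H.m_inv_closed[of "inv x"] by auto
      then show False
        using involutions_outside[OF H(1) out[unfolded q2] h[unfolded q2]] x(2) by blast
    qed
  qed
  moreover have "q \<noteq> 3"
  proof
    assume q3: "q = 3"
    \<comment> \<open>As \<open>p\<close> is odd, a point fixed by \<open>f \<circ> f\<close> and by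
      \<open>f ^^ p\<close> is fixed by \<open>f\<close>.\<close>
    have free2: "x = \<one>" if x: "x \<in> carrier G" and ff: "(f \<circ> f) x = x" for x
    proof -
      have even_pow: "(f ^^ (2 * m)) x = x" for m
        by (induction m) (use ff in simp_all)
      obtain m where m: "p = Suc (2 * m)" using p3(2) by (metis oddE Suc_eq_plus1)
      have "f x = (f ^^ p) x" unfolding m by (simp add: even_pow)
      then show "x = \<one>" using period[OF x] free[OF x] by simp
    qed
    have "f \<circ> f \<in> hom G G" using funpow_hom[OF f, of 2] by (simp add: numeral_2_eq_2)
    from fixed_point_free_escapes[OF fin this free2 H.subset H(2)]
    obtain x where x: "x \<in> carrier G" "inv x \<otimes> f (f x) \<notin> H" by auto
    have nx: "x \<notin> H"
    proof
      assume "x \<in> H"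
      then show False using x fH[OF fH[OF \<open>x \<in> H\<close>]] by blast
    qed
    \<comment> \<open>Modulo \<open>H\<close>, \<open>f\<close> sends \<open>x\<close> to itself or
      to its inverse, and in either case \<open>f \<circ> f\<close> fixes its coset.\<close>
    have two: "x \<otimes> f x \<in> H \<or> inv x \<otimes> f x \<in> H"
      using cube_outside[OF H(1) out[unfolded q3] h(1), of x "f x"] h(2) q3 nx x f_out[of x] by auto
    have car: "f x \<in> carrier G" "f (f x) \<in> carrier G" using x by auto
    from two have "inv x \<otimes> f (f x) \<in> H"
    proof
      assume 1: "inv x \<otimes> f x \<in> H"
      then have "f (inv x \<otimes> f x) \<in> H" by (rule fH)
      then have "(inv x \<otimes> f x) \<otimes> (inv (f x) \<otimes> f (f x)) \<in> H" using 1 x by simp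
      then show ?thesis using x car by (simp add: m_assoc)
    next
      assume 1: "x \<otimes> f x \<in> H"
      then have "f (x \<otimes> f x) \<in> H" by (rule fH)
      moreover have "inv x \<otimes> inv (x \<otimes> f x) \<otimes> x \<in> H" using 1 x H.inv_op_closed1 by auto
      ultimately have "(inv x \<otimes> inv (x \<otimes> f x) \<otimes> x) \<otimes> (f x \<otimes> f (f x)) \<in> H" using x by simp
      then show ?thesis using x car by (simp add: word_simps)
    qed
    then show False using x by simp
  qed
  ultimately have q5: "q \<ge> 5"
    using q(2) prime_ge_2_nat[of q] by (cases "q = 4") auto
  \<comment> \<open>In the shifted filtration \<open>lcs (q - 1)\<close> is the term with index
    \<open>q\<close>, as \<open>exponent_prime\<close> demands.\<close>
  have reg: False if "lcs (q - 1) = {\<one>}"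
    using central_filtration.exponent_prime[OF lcs_filtration q(2) _ H out h(1)] that h(2) by blast
  have antimono: "lcs (q - 1) = {\<one>}" if "lcs b = {\<one>}" "b \<le> q - 1" for b
  proof
    show "lcs (q - 1) \<subseteq> {\<one>}"
      using lift_Suc_antimono_le[of lcs, OF lcs_Suc_subset that(2)] that(1) by simp
    show "{\<one>} \<subseteq> lcs (q - 1)"
      using subgroup.one_closed[OF normal_imp_subgroup[OF lcs_normal]] by simp
  qed
  have "p \<noteq> 3"
  proof
    assume "p = 3"
    then have "lcs 2 = {\<one>}"
      using p(2) period by (intro fixed_point_free_3[OF q _ f free]) auto
    then show False using antimono[of 2] reg q5 by simp
  qed
  moreover have "p \<noteq> 5"
  proof
    assume p5: "p = 5"
    then have "lcs 6 = {\<one>}"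
      using p(2) period by (intro fixed_point_free_5[OF q _ f free]) auto
    \<comment> \<open>With q \<ge> 5 and q \<noteq> p = 5, excluding 6 leaves q \<ge> 7.\<close>
    moreover have "q \<noteq> 6" using q(2) by auto
    then have "6 \<le> q - 1" using q5 p5 p(2) by simp
    ultimately show False using antimono[of 6] reg by simp
  qed
  moreover have "p \<noteq> 4" "p \<noteq> 6" using p(1) by auto
  ultimately show ?thesis using p3 q5 by auto
qed

lemma action_by_conjugation_on_subset:
  assumes H: "subgroup H G" and F: "F \<subseteq> carrier G"
    and conj: "\<And>g x. g \<in> H \<Longrightarrow> x \<in> F \<Longrightarrow> g \<otimes> x \<otimes> inv g \<in> F"
  shows "group_action (G\<lparr>carrier := H\<rparr>) F (\<lambda>g. \<lambda>x\<in>F. g \<otimes> x \<otimes> inv g)"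
proof -
  interpret H: subgroup H G by fact
  have bij: "(\<lambda>x\<in>F. g \<otimes> x \<otimes> inv g) \<in> Bij F" if g: "g \<in> H" for g
  proof -
    have "bij_betw (\<lambda>x\<in>F. g \<otimes> x \<otimes> inv g) F F"
    proof (rule bij_betw_byWitness[of _ "\<lambda>x. inv g \<otimes> x \<otimes> g"])
      have "inv g \<otimes> x \<otimes> g \<in> F" if "x \<in> F" for x
        using conj[OF H.m_inv_closed[OF g] that] g by simp
      then show "(\<lambda>x. inv g \<otimes> x \<otimes> g) ` F \<subseteq> F" by blast
      then show "\<forall>x\<in>F. (\<lambda>x\<in>F. g \<otimes> x \<otimes> inv g) (inv g \<otimes> x \<otimes> g) = x"
        using g F by (auto simp: m_assoc subset_iff)
      show "\<forall>x\<in>F. inv g \<otimes> (\<lambda>x\<in>F. g \<otimes> x \<otimes> inv g) x \<otimes> g = x"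
        using g F by (auto simp: m_assoc subset_iff)
      show "(\<lambda>x\<in>F. g \<otimes> x \<otimes> inv g) ` F \<subseteq> F" using conj[OF g] by auto
    qed
    then show ?thesis by (simp add: Bij_def)
  qed
  show ?thesis
    unfolding group_action_def group_hom_def group_hom_axioms_def
  proof (intro conjI group_BijGroup homI)
    show "group (G\<lparr>carrier := H\<rparr>)" by (rule subgroup_imp_group[OF H])
    show "(\<lambda>x\<in>F. g \<otimes> x \<otimes> inv g) \<in> carrier (BijGroup F)" if "g \<in> carrier (G\<lparr>carrier := H\<rparr>)" for g
      using that bij by (simp add: BijGroup_def)
    show "(\<lambda>x\<in>F. (g \<otimes>\<^bsub>G\<lparr>carrier := H\<rparr>\<^esub> k) \<otimes> x \<otimes> inv (g \<otimes>\<^bsub>G\<lparr>carrier := H\<rparr>\<^esub> k))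
        = (\<lambda>x\<in>F. g \<otimes> x \<otimes> inv g) \<otimes>\<^bsub>BijGroup F\<^esub> (\<lambda>x\<in>F. k \<otimes> x \<otimes> inv k)"
      if "g \<in> carrier (G\<lparr>carrier := H\<rparr>)" "k \<in> carrier (G\<lparr>carrier := H\<rparr>)" for g k
      using that bij conj F
      by (auto simp: BijGroup_def compose_def fun_eq_iff restrict_def word_simps subset_iff)
  qed
qed

end

lemma hughes_subgroup_normal:
  assumes "group K"
  shows "hughes_subgroup r K \<lhd> K"
proof -
  interpret group K by fact
  have pow: "(g \<otimes>\<^bsub>K\<^esub> x \<otimes>\<^bsub>K\<^esub> inv\<^bsub>K\<^esub> g) [^]\<^bsub>K\<^esub> r = g \<otimes>\<^bsub>K\<^esub> x [^]\<^bsub>K\<^esub> r \<otimes>\<^bsub>K\<^esub> inv\<^bsub>K\<^esub> g"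
    if "g \<in> carrier K" "x \<in> carrier K" for g x
    using that by (induction r) (simp_all add: m_assoc)
  have "x [^]\<^bsub>K\<^esub> r = \<one>\<^bsub>K\<^esub>"
    if "(g \<otimes>\<^bsub>K\<^esub> x \<otimes>\<^bsub>K\<^esub> inv\<^bsub>K\<^esub> g) [^]\<^bsub>K\<^esub> r = \<one>\<^bsub>K\<^esub>" "g \<in> carrier K" "x \<in> carrier K" for g x
  proof -
    have "x [^]\<^bsub>K\<^esub> r = inv\<^bsub>K\<^esub> g \<otimes>\<^bsub>K\<^esub> (g \<otimes>\<^bsub>K\<^esub> x [^]\<^bsub>K\<^esub> r \<otimes>\<^bsub>K\<^esub> inv\<^bsub>K\<^esub> g) \<otimes>\<^bsub>K\<^esub> g"
      using that(2,3) by (simp add: m_assoc)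
    also have "\<dots> = inv\<^bsub>K\<^esub> g \<otimes>\<^bsub>K\<^esub> \<one>\<^bsub>K\<^esub> \<otimes>\<^bsub>K\<^esub> g" by (simp only: that(1) flip: pow[OF that(2,3)])
    finally show ?thesis using that(2) by simp
  qed
  then show ?thesis
    unfolding hughes_subgroup_def by (intro normal_generateI) auto
qed

lemma hughes_subgroup_hom_invariant:
  assumes "group K" and f: "f \<in> hom K K" and inj: "\<And>x. x \<in> carrier K \<Longrightarrow> f x = \<one>\<^bsub>K\<^esub> \<Longrightarrow> x = \<one>\<^bsub>K\<^esub>"
    and x: "x \<in> hughes_subgroup r K"
  shows "f x \<in> hughes_subgroup r K"
proof -
  interpret group K by fact
  interpret f: group_hom K K f using f by unfold_locales
  have sub: "subgroup (hughes_subgroup r K) K"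
    unfolding hughes_subgroup_def by (rule generate_is_subgroup) auto
  have gen: "f x \<in> hughes_subgroup r K" if "x \<in> carrier K" "x [^]\<^bsub>K\<^esub> r \<noteq> \<one>\<^bsub>K\<^esub>" for x
  proof -
    have "f x [^]\<^bsub>K\<^esub> r \<noteq> \<one>\<^bsub>K\<^esub>"
      using that inj[of "x [^]\<^bsub>K\<^esub> r"] f.hom_nat_pow[of x r] by auto
    then show ?thesis using that unfolding hughes_subgroup_def by (auto intro!: generate.incl)
  qed
  have car: "generate K {x \<in> carrier K. x [^]\<^bsub>K\<^esub> r \<noteq> \<one>\<^bsub>K\<^esub>} \<subseteq> carrier K"
    by (rule generate_incl) auto
  from x show ?thesis unfolding hughes_subgroup_def
  proof (induction rule: generate.induct)
    case one
    then show ?case by (simp add: generate.one)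
  next
    case (incl h)
    then show ?case using gen[of h] by (simp add: hughes_subgroup_def)
  next
    case (inv h)
    then show ?case
      using gen[of h] subgroup.m_inv_closed[OF sub, of "f h"] by (simp add: hughes_subgroup_def)
  next
    case (eng a b)
    then show ?case using car generate.eng[of "f a" K _ "f b"] by (auto simp: subset_iff)
  qed
qed

theorem mainTheorem2:
  fixes G :: "('a, 'b) monoid_scheme" and H F :: "'a set" and p q :: nat
  assumes "group G" and "finite (carrier G)"
    and "frobenius_complement G H"
    and "F = frobenius_kernel G H"
    and "Factorial_Ring.prime q"
    and "finite_p_group q (G\<lparr>carrier := F\<rparr>)"
    and "\<not> comm_group (G\<lparr>carrier := F\<rparr>)"
    and "{\<one>\<^bsub>G\<^esub>} \<subset> hughes_subgroup q (G\<lparr>carrier := F\<rparr>)"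
    and "hughes_subgroup q (G\<lparr>carrier := F\<rparr>) \<subset> F"
    and "Factorial_Ring.prime p" and "card H = p"
  shows "p \<ge> 7 \<and> q \<ge> 5"
proof -
  interpret G: group G by fact
  define K where "K = G\<lparr>carrier := F\<rparr>"
  have K_simps [simp]: "carrier K = F" "x \<otimes>\<^bsub>K\<^esub> y = x \<otimes>\<^bsub>G\<^esub> y" "\<one>\<^bsub>K\<^esub> = \<one>\<^bsub>G\<^esub>" for x y
    by (simp_all add: K_def)
  obtain n where n: "order K = q ^ n" and K: "group K"
    using assms(6) by (auto simp: finite_p_group_def K_def)
  interpret K: group K by (rule K)
  have H: "subgroup H G" "H \<noteq> {\<one>\<^bsub>G\<^esub>}"
    and trivial: "\<And>g. g \<in> carrier G - H \<Longrightarrow> H \<inter> (g <#\<^bsub>G\<^esub> H #>\<^bsub>G\<^esub> inv\<^bsub>G\<^esub> g) = {\<one>\<^bsub>G\<^esub>}"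
    using assms(3) by (auto simp: frobenius_complement_def)
  interpret H: subgroup H G by (rule H)
  have conj_set: "g <#\<^bsub>G\<^esub> H #>\<^bsub>G\<^esub> inv\<^bsub>G\<^esub> g = (\<lambda>x. g \<otimes>\<^bsub>G\<^esub> x \<otimes>\<^bsub>G\<^esub> inv\<^bsub>G\<^esub> g) ` H" for g
    by (auto simp: l_coset_def r_coset_def)
  have F_iff: "x \<in> F \<longleftrightarrow> x = \<one>\<^bsub>G\<^esub> \<or> x \<in> carrier G \<and> (\<forall>g\<in>carrier G. \<forall>k\<in>H. x \<noteq> g \<otimes>\<^bsub>G\<^esub> k \<otimes>\<^bsub>G\<^esub> inv\<^bsub>G\<^esub> g)" for x
    unfolding assms(4) frobenius_kernel_def conj_set by auto
  have Fc: "F \<subseteq> carrier G" using F_iff by auto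
  have F_conj: "g \<otimes>\<^bsub>G\<^esub> x \<otimes>\<^bsub>G\<^esub> inv\<^bsub>G\<^esub> g \<in> F" if g: "g \<in> carrier G" and x: "x \<in> F" for g x
  proof (rule ccontr)
    assume "g \<otimes>\<^bsub>G\<^esub> x \<otimes>\<^bsub>G\<^esub> inv\<^bsub>G\<^esub> g \<notin> F"
    moreover have xc: "x \<in> carrier G" using x Fc by auto
    ultimately obtain a k where ak: "a \<in> carrier G" "k \<in> H"
      and eq: "g \<otimes>\<^bsub>G\<^esub> x \<otimes>\<^bsub>G\<^esub> inv\<^bsub>G\<^esub> g = a \<otimes>\<^bsub>G\<^esub> k \<otimes>\<^bsub>G\<^esub> inv\<^bsub>G\<^esub> a"
      and ne: "g \<otimes>\<^bsub>G\<^esub> x \<otimes>\<^bsub>G\<^esub> inv\<^bsub>G\<^esub> g \<noteq> \<one>\<^bsub>G\<^esub>"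
      unfolding F_iff[of "g \<otimes>\<^bsub>G\<^esub> x \<otimes>\<^bsub>G\<^esub> inv\<^bsub>G\<^esub> g"] using g by auto
    have kc: "k \<in> carrier G" using ak by auto
    have "x = inv\<^bsub>G\<^esub> g \<otimes>\<^bsub>G\<^esub> (g \<otimes>\<^bsub>G\<^esub> x \<otimes>\<^bsub>G\<^esub> inv\<^bsub>G\<^esub> g) \<otimes>\<^bsub>G\<^esub> g" using g xc by (simp add: G.m_assoc)
    also have "\<dots> = (inv\<^bsub>G\<^esub> g \<otimes>\<^bsub>G\<^esub> a) \<otimes>\<^bsub>G\<^esub> k \<otimes>\<^bsub>G\<^esub> inv\<^bsub>G\<^esub> (inv\<^bsub>G\<^esub> g \<otimes>\<^bsub>G\<^esub> a)"
      unfolding eq using g ak kc by (simp add: G.word_simps)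
    finally have "x = \<one>\<^bsub>G\<^esub>" using x F_iff[of x] g ak by blast
    then show False using ne g by simp
  qed
  \<comment> \<open>As \<open>p\<close> is prime, any nontrivial element generates the complement;
    conjugation by it is the automorphism.\<close>
  obtain h where h: "h \<in> H" "h \<noteq> \<one>\<^bsub>G\<^esub>" using H(2) H.one_closed by blast
  have hc: "h \<in> carrier G" using h by auto
  define f where "f x = h \<otimes>\<^bsub>G\<^esub> x \<otimes>\<^bsub>G\<^esub> inv\<^bsub>G\<^esub> h" for x
  \<comment> \<open>A fixed point \<open>x\<close> commutes with \<open>h\<close>, so
    \<open>h\<close> lies in both \<open>H\<close> and its conjugate by \<open>x\<close>, although
    \<open>x\<close> is outside \<open>H\<close>.\<close>
  have free: "x = \<one>\<^bsub>G\<^esub>" if x: "x \<in> F" "f x = x" for x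
  proof (rule ccontr)
    assume "x \<noteq> \<one>\<^bsub>G\<^esub>"
    have xc: "x \<in> carrier G" using x Fc by auto
    have "x \<notin> H"
    proof
      assume "x \<in> H"
      moreover have "x = \<one>\<^bsub>G\<^esub> \<otimes>\<^bsub>G\<^esub> x \<otimes>\<^bsub>G\<^esub> inv\<^bsub>G\<^esub> \<one>\<^bsub>G\<^esub>" using xc by simp
      ultimately show False using x(1) F_iff[of x] \<open>x \<noteq> \<one>\<^bsub>G\<^esub>\<close> by blast
    qed
    have "h \<otimes>\<^bsub>G\<^esub> x = f x \<otimes>\<^bsub>G\<^esub> h" using hc xc by (simp add: f_def G.m_assoc)
    then have hx: "h \<otimes>\<^bsub>G\<^esub> x = x \<otimes>\<^bsub>G\<^esub> h" using x(2) by simp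
    have "x \<otimes>\<^bsub>G\<^esub> h \<otimes>\<^bsub>G\<^esub> inv\<^bsub>G\<^esub> x = h \<otimes>\<^bsub>G\<^esub> x \<otimes>\<^bsub>G\<^esub> inv\<^bsub>G\<^esub> x" by (simp only: hx)
    then have "h = x \<otimes>\<^bsub>G\<^esub> h \<otimes>\<^bsub>G\<^esub> inv\<^bsub>G\<^esub> x" using hc xc by (simp add: G.m_assoc)
    then have "h \<in> H \<inter> (x <#\<^bsub>G\<^esub> H #>\<^bsub>G\<^esub> inv\<^bsub>G\<^esub> x)" unfolding conj_set using h(1) by blast
    then show False using trivial[of x] xc \<open>x \<notin> H\<close> h(2) by auto
  qed
  have f_hom: "f \<in> hom K K"
    using F_conj hc Fc by (auto simp: hom_def f_def G.m_assoc subset_iff)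
  have f_pow: "(f ^^ k) x = h [^]\<^bsub>G\<^esub> k \<otimes>\<^bsub>G\<^esub> x \<otimes>\<^bsub>G\<^esub> inv\<^bsub>G\<^esub> (h [^]\<^bsub>G\<^esub> k)" if "x \<in> carrier G" for k x
  proof (induction k)
    case (Suc k)
    have "h [^]\<^bsub>G\<^esub> Suc k = h \<otimes>\<^bsub>G\<^esub> h [^]\<^bsub>G\<^esub> k" by (rule G.nat_pow_Suc2[OF hc])
    then show ?case using Suc that hc by (simp add: f_def G.word_simps del: G.nat_pow_Suc)
  qed (use that in simp)
  have "h [^]\<^bsub>G\<^esub> p = \<one>\<^bsub>G\<^esub>"
  proof -
    interpret GH: group "G\<lparr>carrier := H\<rparr>" by (rule G.subgroup_imp_group[OF H(1)])
    have "h [^]\<^bsub>G\<lparr>carrier := H\<rparr>\<^esub> order (G\<lparr>carrier := H\<rparr>) = \<one>\<^bsub>G\<lparr>carrier := H\<rparr>\<^esub>"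
      by (rule GH.pow_order_eq_1) (use h in simp)
    then show ?thesis using assms(11) by (simp add: order_def flip: G.nat_pow_consistent)
  qed
  then have period: "(f ^^ p) x = x" if "x \<in> F" for x
    using f_pow[of x p] that Fc by auto
  \<comment> \<open>Otherwise \<open>H\<close> would be a q-group acting on \<open>F\<close> with
    the identity as its only fixed point, and \<open>p\<close> would divide both
    \<open>q ^ n\<close> and \<open>q ^ n - 1\<close>.\<close>
  have "p \<noteq> q"
  proof
    assume pq: "p = q"
    let ?Fix = "{x \<in> F. \<forall>g\<in>carrier (G\<lparr>carrier := H\<rparr>). (\<lambda>x\<in>F. g \<otimes>\<^bsub>G\<^esub> x \<otimes>\<^bsub>G\<^esub> inv\<^bsub>G\<^esub> g) x = x}"
    have "group_action (G\<lparr>carrier := H\<rparr>) F (\<lambda>g. \<lambda>x\<in>F. g \<otimes>\<^bsub>G\<^esub> x \<otimes>\<^bsub>G\<^esub> inv\<^bsub>G\<^esub> g)"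
      by (rule G.action_by_conjugation_on_subset[OF H(1) Fc]) (use F_conj in auto)
    moreover have "finite F" using Fc assms(2) finite_subset by blast
    moreover have "order (G\<lparr>carrier := H\<rparr>) = p ^ 1" using assms(11) by (simp add: order_def)
    ultimately have dvd: "p dvd card F - card ?Fix"
      using prime_power_action_fixed_points assms(10) by blast
    have "?Fix = {\<one>\<^bsub>G\<^esub>}"
    proof
      show "?Fix \<subseteq> {\<one>\<^bsub>G\<^esub>}" using free h(1) by (auto simp: f_def)
      show "{\<one>\<^bsub>G\<^esub>} \<subseteq> ?Fix" using F_iff by auto
    qed
    then have "p dvd card F - 1" using dvd by simp
    moreover have "card F = q ^ n" using n by (simp add: order_def)
    moreover have "n \<noteq> 0"
    proof
      assume "n = 0"
      then have "card F = 1" using \<open>card F = q ^ n\<close> by simp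
      then obtain z where "F = {z}" using card_1_singletonE by blast
      then have "comm_group K" by (intro K.group_comm_groupI) auto
      then show False using assms(7) by (simp add: K_def)
    qed
    ultimately have "p dvd q ^ n - 1" "p dvd q ^ n" using pq by (auto simp: dvd_power)
    moreover have "q ^ n \<ge> 1" using assms(5) prime_gt_0_nat by (simp add: Suc_leI)
    ultimately have "p dvd 1" using dvd_diffD1 by blast
    then show False using assms(10) by simp
  qed
  have hug: "hughes_subgroup q K \<subset> F" "{\<one>\<^bsub>G\<^esub>} \<subset> hughes_subgroup q K"
    using assms(8,9) by (simp_all add: K_def)
  obtain k where k: "k \<in> F" "k [^]\<^bsub>K\<^esub> q \<noteq> \<one>\<^bsub>K\<^esub>"
  proof (rule ccontr)
    assume "\<not> thesis"
    then have empty: "{x \<in> carrier K. x [^]\<^bsub>K\<^esub> q \<noteq> \<one>\<^bsub>K\<^esub>} = {}" using that by auto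
    have "hughes_subgroup q K = {\<one>\<^bsub>K\<^esub>}"
      unfolding hughes_subgroup_def empty by (rule K.generate_empty)
    then show False using hug by simp
  qed
  have generators: "x \<in> hughes_subgroup q K" if "x \<in> F" "x [^]\<^bsub>K\<^esub> q \<noteq> \<one>\<^bsub>K\<^esub>" for x
    unfolding hughes_subgroup_def using that by (auto intro!: generate.incl)
  have ker: "x = \<one>\<^bsub>K\<^esub>" if "x \<in> carrier K" "f x = \<one>\<^bsub>K\<^esub>" for x
  proof -
    have "x \<in> carrier G" using that Fc by auto
    then have "x = inv\<^bsub>G\<^esub> h \<otimes>\<^bsub>G\<^esub> f x \<otimes>\<^bsub>G\<^esub> h" using hc by (simp add: f_def G.m_assoc)
    then show ?thesis using that hc by simp
  qed
  show ?thesis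
  proof (rule K.fixed_point_free_hughes_bound[OF n assms(5,10) \<open>p \<noteq> q\<close> f_hom])
    show "hughes_subgroup q K \<lhd> K" by (rule hughes_subgroup_normal[OF K])
    show "f x \<in> hughes_subgroup q K" if "x \<in> hughes_subgroup q K" for x
      by (rule hughes_subgroup_hom_invariant[OF K f_hom ker that])
    show "k \<in> hughes_subgroup q K" by (rule generators[OF k])
    show "\<not> comm_group K" using assms(7) by (simp add: K_def)
    show "x = \<one>\<^bsub>K\<^esub>" if "x \<in> carrier K" "f x = x" for x using free[of x] that by simp
    show "(f ^^ p) x = x" if "x \<in> carrier K" for x using period[of x] that by simp
    show "hughes_subgroup q K \<noteq> carrier K" using hug(1) by simp
    show "x [^]\<^bsub>K\<^esub> q = \<one>\<^bsub>K\<^esub>" if "x \<in> carrier K - hughes_subgroup q K" for x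
      using generators[of x] that by auto
  qed (rule k(2))
qed

end
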